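(* Let $n\ge 1$ and let $A=(a_{ij})_{1\le i,j\le n}$ be a complex $n\times n$ matrix. Then $A(\mathbb{C}_+^n\setminus\{0\})\subset \mathrm{Int}\,\mathbb{C}_+^n$ if and only if for all indices $k,l,p,q\in\{1,\dots,n\}$ $$ \Re(\overline{a_{kp}} a_{lq} + \overline{a_{kq}} a_{lp} ) > | a_{kp} a_{lq} - a_{kq} a_{lp} |. $$ If $A$ satisfies these equivalent conditions, then $A$ has a spectral gap: it has a unique eigenvalue $\lambda_m$ of maximal modulus, this eigenvalue is simple, and all other eigenvalues are of modulus not greater than $c|\lambda_m|$, where $c=\tanh(\Delta/4)<1$ and $\Delta=\sup_{x,y\in\mathbb{C}_+^n\setminus\{0\}}\delta_{\mathbb{C}_+^n}(Ax,Ay)$ is the diameter of $A(\mathbb{C}_+^n\setminus\{0\})$ with respect to $\delta_{\mathbb{C}_+^n}$. Moreover, if $\theta\in(0,1)$ and $\sigma>1$ are such that for all indices $k,l,p,q$ $$ \Re(\overline{a_{kp}} a_{lq} + \overline{a_{kq}} a_{lp} ) >\frac{1}{\theta} | a_{kp} a_{lq} - a_{kq} a_{lp} | \quad\text{and}\quad |a_{kp}a_{lq}|\leq \sigma^2 |a_{kq}a_{lp}|, $$ then $$ \Delta \leq 8 \log \frac{1+\theta}{1-\theta} + 2\log \sigma. $$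
   Context: $\mathbb{C}_+^n=\{v\in\mathbb{C}^n:\ \forall k,l,\ \Re(v_k\overline{v_l})\geq 0\}$ and $\mathrm{Int}\,\mathbb{C}_+^n=\{v\in\mathbb{C}^n:\ \forall k,l,\ \Re(v_k\overline{v_l})>0\}$. Projective metric: put $C=\mathbb{C}_+^n$. For $x,y\in C\setminus\{0\}$ let $E_C(x,y)=\{z\in\mathbb{C}: zx-y\notin C\}$. If $x,y$ are (complex) colinear, $\delta_C(x,y)=0$. If $x,y$ are linearly independent, $\delta_C(x,y)=\log(b/a)\in[0,\infty]$, where $b=\sup\{|z|:z\in E_C(x,y)\}\in(0,\infty]$ and $a=\inf\{|z|:z\in E_C(x,y)\}\in[0,\infty)$ (with $\log(b/a)=\infty$ if $b=\infty$ or $a=0$). *)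

theory Defs
  imports "HOL-Library.Extended_Real" "Jordan_Normal_Form.Char_Poly"
begin

definition cone_plus :: "nat \<Rightarrow> complex vec set" where
  "cone_plus n = {v \<in> carrier_vec n. \<forall>k<n. \<forall>l<n. Re (v $ k * cnj (v $ l)) \<ge> 0}"

definition int_cone_plus :: "nat \<Rightarrow> complex vec set" where
  "int_cone_plus n = {v \<in> carrier_vec n. \<forall>k<n. \<forall>l<n. Re (v $ k * cnj (v $ l)) > 0}"

definition colinear :: "complex vec \<Rightarrow> complex vec \<Rightarrow> bool" where
  "colinear x y \<longleftrightarrow>
     (\<exists>\<alpha> \<beta>. (\<alpha> \<noteq> 0 \<or> \<beta> \<noteq> 0) \<and> \<alpha> \<cdot>\<^sub>v x + \<beta> \<cdot>\<^sub>v y = 0\<^sub>v (dim_vec x))"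

definition E_set :: "complex vec set \<Rightarrow> complex vec \<Rightarrow> complex vec \<Rightarrow> complex set" where
  "E_set C x y = {z. z \<cdot>\<^sub>v x - y \<notin> C}"

(* Meaningful for x, y in C - {0} of equal dimension.  For linearly independent x, y in
   cone_plus n the set E_set is nonempty and not {0}, so 0 < b and a < \<infinity>. *)
definition proj_metric :: "complex vec set \<Rightarrow> complex vec \<Rightarrow> complex vec \<Rightarrow> ereal" where
  "proj_metric C x y =
     (if colinear x y then 0
      else let b = (SUP z\<in>E_set C x y. ereal (cmod z));
               a = (INF z\<in>E_set C x y. ereal (cmod z))
           in if b = \<infinity> \<or> a = 0 then \<infinity>
              else ereal (ln (real_of_ereal b / real_of_ereal a)))"

definition image_diameter :: "nat \<Rightarrow> complex mat \<Rightarrow> ereal" where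
  "image_diameter n A =
     (SUP x\<in>cone_plus n - {0\<^sub>v n}. SUP y\<in>cone_plus n - {0\<^sub>v n}.
        proj_metric (cone_plus n) (A *\<^sub>v x) (A *\<^sub>v y))"

definition max_modulus_eigenvalue :: "complex mat \<Rightarrow> complex \<Rightarrow> bool" where
  "max_modulus_eigenvalue A ev \<longleftrightarrow>
     eigenvalue A ev \<and> (\<forall>\<mu>. eigenvalue A \<mu> \<longrightarrow> cmod \<mu> \<le> cmod ev)"

(* An eigenvalue is simple when its algebraic multiplicity, order ev (char_poly A), is 1. *)
definition spectral_gap :: "complex mat \<Rightarrow> real \<Rightarrow> bool" where
  "spectral_gap A c \<longleftrightarrow>
     (\<exists>ev. max_modulus_eigenvalue A ev
         \<and> (\<forall>\<mu>. max_modulus_eigenvalue A \<mu> \<longrightarrow> \<mu> = ev)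
         \<and> order ev (char_poly A) = 1
         \<and> (\<forall>\<mu>. eigenvalue A \<mu> \<and> \<mu> \<noteq> ev \<longrightarrow> cmod \<mu> \<le> c * cmod ev))"

end

theory Submission
  imports Defs "Jordan_Normal_Form.Schur_Decomposition"
begin

text \<open>The proof rests on discs and on duality.

  For \<open>x\<close> in the interior of the cone and any \<open>y\<close>, a number \<open>z\<close> with \<open>z x - y\<close> outside the cone
  violates the condition for some pair of coordinates, and each pair cuts out a disc with explicit
  centre and radius (\<open>disc_identity\<close>). Duality says that a functional has no zero on the cone minus
  the origin exactly when its coefficient vector is in the interior (\<open>pairing_nonzero\<close>,
  \<open>annihilated_vector\<close>). Consequently the values on the cone of the quotient of two rows of \<open>A\<close> are
  exactly the points of the closed discs formed with these rows, and \<open>A\<close> maps the cone into its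
  interior if and only if all these discs lie in the open right half-plane. Comparing the real part
  of the centre with the radius gives the condition on the entries.

  For the diameter bound, the stronger condition makes the radius at most \<open>\<theta>\<close> times the real part of
  the centre. Then \<open>|1 + \<zeta> s|\<close> varies on such a disc at most by the factor \<open>(1 + \<theta>) / (1 - \<theta>)\<close>,
  for every \<open>\<zeta>\<close> in the closed right half-plane. Chaining three discs compares arbitrary points of the
  cone (\<open>pencil_distortion\<close>), and two such chains together with one comparison of moduli between two
  rows account for the eight factors and for \<open>\<sigma>\<^sup>2\<close>.

  For the spectral gap, let \<open>closed_E n x y\<close> be the set of \<open>z\<close> for which \<open>z x - y\<close> is not in the
  interior. The diameter \<open>\<Delta>\<close> controls the cross-ratio of four suitable points on a line, and this
  shows that passing from \<open>x\<close>, \<open>y\<close> to \<open>A x\<close>, \<open>A y\<close> contracts the Euclidean diameter of this set by the factor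
  \<open>tanh (\<Delta> / 4)\<close> (\<open>closed_E_contraction\<close>). Applied along an orbit this yields an eigenvector \<open>h\<close> in the
  interior, with eigenvalue \<open>ev\<close> say. Applied to \<open>h\<close> and an eigenvector \<open>w\<close> for \<open>\<mu>\<close> it gives the
  gap at once: the set for \<open>A h\<close>, \<open>A w\<close> is the set for \<open>h\<close>, \<open>w\<close> multiplied by \<open>\<mu> / ev\<close>, so either its
  diameter vanishes and \<open>w\<close> is a multiple of \<open>h\<close>, or \<open>|\<mu>| \<le> tanh (\<Delta> / 4) |ev|\<close>. The same argument
  for generalised eigenvectors shows that \<open>ev\<close> is simple.\<close>

section \<open>Discs cut out by pairs of coordinates\<close>

text \<open>For \<open>x\<close> in the interior of the cone, the points \<open>z\<close> at which coordinates \<open>k\<close> and \<open>l\<close> of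
  \<open>z x - y\<close> violate the cone condition form an open disc, possibly empty; these are its centre and radius. With two
  rows of a matrix in the place of \<open>x\<close> and \<open>y\<close> they turn into the two sides of the entry condition,
  up to a common positive factor.\<close>

definition disc_centre :: "complex vec \<Rightarrow> complex vec \<Rightarrow> nat \<Rightarrow> nat \<Rightarrow> complex" where
  "disc_centre x y k l =
     (cnj (x $ k) * y $ l + cnj (x $ l) * y $ k) / complex_of_real (2 * Re (x $ k * cnj (x $ l)))"

definition disc_radius :: "complex vec \<Rightarrow> complex vec \<Rightarrow> nat \<Rightarrow> nat \<Rightarrow> real" where
  "disc_radius x y k l =
     cmod (x $ k * y $ l - x $ l * y $ k) / (2 * Re (x $ k * cnj (x $ l)))"

lemma polarisation_identity:
  fixes a b u v :: complex
  shows "(cmod (cnj a * v + cnj b * u))\<^sup>2 - (cmod (a * v - b * u))\<^sup>2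
    = 4 * Re (a * cnj b) * Re (u * cnj v)"
  unfolding cmod_power2 by (simp add: algebra_simps power2_eq_square)

text \<open>The left-hand side is a Hermitian quadratic polynomial in \<open>z\<close> with positive leading coefficient.
  Completing the square gives the centre, and the polarisation identity evaluates the discriminant.\<close>

lemma disc_identity:
  fixes x y :: "complex vec"
  assumes pos: "Re (x $ k * cnj (x $ l)) > 0"
  shows "Re ((z * x $ k - y $ k) * cnj (z * x $ l - y $ l)) =
    Re (x $ k * cnj (x $ l)) * ((cmod (z - disc_centre x y k l))\<^sup>2 - (disc_radius x y k l)\<^sup>2)"
proof -
  define \<alpha> where "\<alpha> = Re (x $ k * cnj (x $ l))"
  define N where "N = cnj (x $ k) * y $ l + cnj (x $ l) * y $ k"
  define D where "D = x $ k * y $ l - x $ l * y $ k"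
  have \<alpha>: "\<alpha> > 0" using pos by (simp add: \<alpha>_def)
  have ND: "(cmod N)\<^sup>2 - (cmod D)\<^sup>2 = 4 * \<alpha> * Re (y $ k * cnj (y $ l))"
    unfolding N_def D_def \<alpha>_def by (rule polarisation_identity)
  have c: "disc_centre x y k l = N / complex_of_real (2 * \<alpha>)"
    and r: "disc_radius x y k l = cmod D / (2 * \<alpha>)"
    by (simp_all add: disc_centre_def disc_radius_def N_def D_def \<alpha>_def)
  have sq: "(cmod (z - w))\<^sup>2 = (cmod z)\<^sup>2 - 2 * Re (z * cnj w) + (cmod w)\<^sup>2" for w
    unfolding cmod_power2 by (simp add: algebra_simps power2_eq_square)
  have zc: "Re (z * cnj (disc_centre x y k l)) = Re (z * cnj N) / (2 * \<alpha>)"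
    unfolding c by (simp only: complex_cnj_divide complex_cnj_complex_of_real times_divide_eq_right Re_divide_of_real)
  have cc: "cmod (disc_centre x y k l) = cmod N / (2 * \<alpha>)"
    unfolding c norm_divide norm_of_real using \<alpha> by simp
  have "\<alpha> * ((cmod (z - disc_centre x y k l))\<^sup>2 - (disc_radius x y k l)\<^sup>2)
      = \<alpha> * (cmod z)\<^sup>2 - Re (z * cnj N) + ((cmod N)\<^sup>2 - (cmod D)\<^sup>2) / (4 * \<alpha>)"
    unfolding sq zc cc r using \<alpha> by (simp add: field_simps power2_eq_square)
  also have "\<dots> = \<alpha> * (cmod z)\<^sup>2 - Re (z * cnj N) + Re (y $ k * cnj (y $ l))"
    unfolding ND using \<alpha> by simp
  also have "\<dots> = Re ((z * x $ k - y $ k) * cnj (z * x $ l - y $ l))"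
    unfolding cmod_power2 N_def \<alpha>_def by (simp add: algebra_simps power2_eq_square)
  finally show ?thesis by (simp add: \<alpha>_def)
qed

lemma disc_radius_nonneg:
  "Re (x $ k * cnj (x $ l)) > 0 \<Longrightarrow> disc_radius x y k l \<ge> 0"
  by (simp add: disc_radius_def)

lemma mem_disc_iff:
  assumes "Re (x $ k * cnj (x $ l)) > 0"
  shows "Re ((z * x $ k - y $ k) * cnj (z * x $ l - y $ l)) \<le> 0
    \<longleftrightarrow> cmod (z - disc_centre x y k l) \<le> disc_radius x y k l"
  unfolding disc_identity[OF assms]
  using assms disc_radius_nonneg[OF assms, of y]
  by (simp add: mult_le_0_iff abs_le_square_iff[symmetric])

lemma mem_open_disc_iff:
  assumes "Re (x $ k * cnj (x $ l)) > 0"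
  shows "Re ((z * x $ k - y $ k) * cnj (z * x $ l - y $ l)) < 0
    \<longleftrightarrow> cmod (z - disc_centre x y k l) < disc_radius x y k l"
  unfolding disc_identity[OF assms]
  using assms disc_radius_nonneg[OF assms, of y]
  by (simp add: mult_less_0_iff abs_square_less_1 power2_less_imp_less) 
     (meson abs_le_square_iff norm_ge_zero not_le power2_less_imp_less power_strict_mono zero_less_numeral)

section \<open>Duality between the cone and its interior\<close>

text \<open>The cone condition bounds each pairwise angle by a right angle. This places all coordinates in one
  quarter-plane: measured from a fixed nonzero coordinate, the arguments have absolute value at most
  \<open>\<pi>/2\<close>, so they do not wrap around and their differences are the pairwise angles. The phase
  \<open>\<phi>\<close> is that of the coordinate of least argument. Vanishing coordinates get
  the angle of the reference coordinate.\<close>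

lemma sector_angles:
  fixes v :: "complex vec"
  assumes v: "\<And>k l. k < n \<Longrightarrow> l < n \<Longrightarrow> Re (v $ k * cnj (v $ l)) \<ge> 0"
  obtains \<phi> t where "\<And>k. k < n \<Longrightarrow> v $ k = rcis (cmod (v $ k)) (\<phi> + t k)"
    and "\<And>k. k < n \<Longrightarrow> 0 \<le> t k" and "\<And>k. k < n \<Longrightarrow> t k \<le> pi / 2"
    and "(\<And>k l. k < n \<Longrightarrow> l < n \<Longrightarrow> Re (v $ k * cnj (v $ l)) > 0) \<Longrightarrow> (\<And>k. k < n \<Longrightarrow> t k < pi / 2)"
proof (cases "\<exists>j<n. v $ j \<noteq> 0")
  case False
  then show ?thesis
    by (intro that[of 0 "\<lambda>_. 0"]) (auto simp: rcis_def)
next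
  case True
  then obtain j where j: "j < n" "v $ j \<noteq> 0" by auto
  define a where "a k = Arg (v $ k / v $ j)" for k
  have re: "Re (v $ k / v $ j) \<ge> 0" if "k < n" for k
    using v[OF that j(1)] by (simp add: Re_complex_div_ge_0)
  have a0: "a k = 0" if "v $ k = 0" for k using that by (simp add: a_def Arg_zero)
  have aj: "a j = 0" using j by (simp add: a_def cis_Arg_unique)
  have polar: "v $ k = rcis (cmod (v $ k)) (Arg (v $ j) + a k)" for k
  proof -
    have "v $ k = v $ j * (v $ k / v $ j)" using j by simp
    also have "\<dots> = rcis (cmod (v $ j)) (Arg (v $ j)) * rcis (cmod (v $ k / v $ j)) (a k)"
      unfolding a_def by (simp only: rcis_cmod_Arg)
    also have "\<dots> = rcis (cmod (v $ k)) (Arg (v $ j) + a k)"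
      using j by (simp add: rcis_mult norm_divide)
    finally show ?thesis .
  qed
  have prodre: "Re (v $ k * cnj (v $ l)) = cmod (v $ k) * cmod (v $ l) * cos (a k - a l)" for k l
  proof -
    have "v $ k * cnj (v $ l) = rcis (cmod (v $ k)) (Arg (v $ j) + a k) * cnj (rcis (cmod (v $ l)) (Arg (v $ j) + a l))"
      using polar[of k] polar[of l] by simp
    also have "\<dots> = rcis (cmod (v $ k) * cmod (v $ l)) (a k - a l)"
      by (simp add: rcis_def cis_cnj cis_mult mult.assoc mult.left_commute)
    finally show ?thesis by simp
  qed
  have abound: "\<bar>a k\<bar> \<le> pi / 2" if k: "k < n" for k
  proof (cases "v $ k = 0")
    case True then show ?thesis by (simp add: a0)
  next
    case False
    have c: "cos \<bar>a k\<bar> \<ge> 0"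
      using v[OF k j(1)] False j unfolding prodre aj diff_zero cos_abs_real
      by (simp only: zero_le_mult_iff zero_less_norm_iff) (metis mult_pos_pos not_less zero_less_norm_iff)
    have "\<bar>a k\<bar> \<le> pi" using Arg_bounded[of "v $ k / v $ j"] by (simp add: a_def abs_le_iff)
    show ?thesis
    proof (rule ccontr)
      assume "\<not> ?thesis"
      then have "cos \<bar>a k\<bar> < cos (pi / 2)"
        using \<open>\<bar>a k\<bar> \<le> pi\<close> by (intro cos_monotone_0_pi) auto
      with c show False by simp
    qed
  qed
  have adiff: "\<bar>a k - a l\<bar> \<le> pi / 2" if k: "k < n" and l: "l < n" for k l
  proof (cases "v $ k = 0 \<or> v $ l = 0")
    case True then show ?thesis using a0 abound k l by force
  next
    case False
    have c: "cos \<bar>a k - a l\<bar> \<ge> 0"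
      using v[OF k l] False unfolding prodre cos_abs_real
      by (simp only: zero_le_mult_iff zero_less_norm_iff) (metis mult_pos_pos not_less zero_less_norm_iff)
    have "\<bar>a k - a l\<bar> \<le> pi" using abound[OF k] abound[OF l] by linarith
    show ?thesis
    proof (rule ccontr)
      assume "\<not> ?thesis"
      then have "cos \<bar>a k - a l\<bar> < cos (pi / 2)"
        using \<open>\<bar>a k - a l\<bar> \<le> pi\<close> by (intro cos_monotone_0_pi) auto
      with c show False by simp
    qed
  qed
  define m where "m = Min (a ` {..<n})"
  have m: "m \<in> a ` {..<n}" unfolding m_def using j by (intro Min_in) auto
  then obtain i where i: "i < n" "m = a i" by auto
  have mle: "m \<le> a k" if "k < n" for k unfolding m_def using that by auto
  show ?thesis
  proof (rule that[of "Arg (v $ j) + m" "\<lambda>k. a k - m"])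
    show "v $ k = rcis (cmod (v $ k)) (Arg (v $ j) + m + (a k - m))" for k
      using polar[of k] by simp
    show "0 \<le> a k - m" if "k < n" for k using mle[OF that] by simp
    show "a k - m \<le> pi / 2" if "k < n" for k
      using adiff[OF that i(1)] i(2) by linarith
    show "a k - m < pi / 2"
      if st: "\<And>k l. k < n \<Longrightarrow> l < n \<Longrightarrow> Re (v $ k * cnj (v $ l)) > 0" and k: "k < n" for k
    proof -
      have "cos (a k - a i) > 0" using st[OF k i(1)] unfolding prodre
        by (metis mult_nonneg_nonneg norm_ge_zero mult_nonneg_nonpos not_less)
      then have "a k - a i \<noteq> pi / 2" by (metis cos_pi_half less_irrefl)
      then show ?thesis using adiff[OF k i(1)] i(2) by linarith
    qed
  qed
qed

text \<open>The terms of the sum have arguments that spread over the sum of a sector of opening less than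
  \<open>\<pi>/2\<close> and one of opening at most \<open>\<pi>/2\<close>. So they lie in a sector of opening less than
  \<open>\<pi>\<close>, which a rotation by \<open>\<omega>\<close> centres on the positive real axis; there every nonzero term has
  positive real part.\<close>

lemma pairing_nonzero:
  fixes c x :: "complex vec"
  assumes c: "c \<in> int_cone_plus n" and x: "x \<in> cone_plus n" "x \<noteq> 0\<^sub>v n"
  shows "c \<bullet> x \<noteq> 0"
proof -
  have cd: "\<And>k l. k < n \<Longrightarrow> l < n \<Longrightarrow> Re (c $ k * cnj (c $ l)) > 0"
    and xd: "\<And>k l. k < n \<Longrightarrow> l < n \<Longrightarrow> Re (x $ k * cnj (x $ l)) \<ge> 0"
    and dim: "dim_vec x = n" using c x by (auto simp: int_cone_plus_def cone_plus_def)
  obtain j where j: "j < n" "x $ j \<noteq> 0" using x dim by (metis eq_vecI index_zero_vec)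
  obtain \<phi> s where s: "\<And>k. k < n \<Longrightarrow> c $ k = rcis (cmod (c $ k)) (\<phi> + s k)"
      "\<And>k. k < n \<Longrightarrow> 0 \<le> s k" "\<And>k. k < n \<Longrightarrow> s k < pi / 2"
    using sector_angles[of n c] cd by (metis less_imp_le)
  obtain \<psi> t where t: "\<And>k. k < n \<Longrightarrow> x $ k = rcis (cmod (x $ k)) (\<psi> + t k)"
      "\<And>k. k < n \<Longrightarrow> 0 \<le> t k" "\<And>k. k < n \<Longrightarrow> t k \<le> pi / 2"
    using sector_angles[of n x] xd by metis
  define \<beta> where "\<beta> = Max ((\<lambda>k. s k + t k) ` {..<n})"
  have "\<beta> \<in> (\<lambda>k. s k + t k) ` {..<n}" unfolding \<beta>_def using j by (intro Max_in) auto
  then obtain i where i: "i < n" "\<beta> = s i + t i" by auto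
  then have \<beta>: "\<beta> < pi" using s(3)[OF i(1)] t(3)[OF i(1)] by simp
  have \<beta>max: "s k + t k \<le> \<beta>" if "k < n" for k unfolding \<beta>_def using that by auto
  define \<omega> where "\<omega> = cis (- \<phi> - \<psi> - \<beta> / 2)"
  have prod: "Re (\<omega> * (c $ k * x $ k)) = cmod (c $ k) * cmod (x $ k) * cos (s k + t k - \<beta> / 2)"
    if k: "k < n" for k
  proof -
    have "\<omega> * (c $ k * x $ k) = \<omega> * (rcis (cmod (c $ k)) (\<phi> + s k) * rcis (cmod (x $ k)) (\<psi> + t k))"
      using s(1)[OF k] t(1)[OF k] by simp
    also have "\<dots> = rcis (cmod (c $ k) * cmod (x $ k)) (s k + t k - \<beta> / 2)"
      unfolding \<omega>_def rcis_mult cis_rcis_eq by (simp add: algebra_simps)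
    finally show ?thesis by simp
  qed
  have cpos: "cos (s k + t k - \<beta> / 2) > 0" if k: "k < n" for k
    using \<beta>max[OF k] s(2)[OF k] t(2)[OF k] \<beta> by (intro cos_gt_zero_pi) (auto simp: field_simps)
  have ne: "c $ k \<noteq> 0" if "k < n" for k using cd[OF that that] by auto
  have "Re (\<omega> * (c \<bullet> x)) = (\<Sum>k<n. Re (\<omega> * (c $ k * x $ k)))"
    unfolding scalar_prod_def dim by (simp add: sum_distrib_left lessThan_atLeast0)
  also have "\<dots> > 0"
  proof (rule sum_pos2[of _ j])
    show "0 < Re (\<omega> * (c $ j * x $ j))"
      unfolding prod[OF j(1)] using j ne[OF j(1)] cpos[OF j(1)] by simp
    show "0 \<le> Re (\<omega> * (c $ k * x $ k))" if "k \<in> {..<n}" for k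
    proof -
      have k: "k < n" using that by simp
      show ?thesis unfolding prod[OF k] using cpos[OF k] by (simp add: less_imp_le)
    qed
  qed (use j in auto)
  finally show ?thesis by auto
qed

text \<open>Together with the preceding lemma this makes the interior exactly the set of functionals without zeros in the
  cone. The vector is supported on the two offending coordinates: \<open>(c\<^sub>l, - c\<^sub>k)\<close> solves the
  equation and, because of the sign change, satisfies the cone condition. It degenerates when \<open>c\<^sub>k = 0\<close>, where a unit vector does.\<close>

lemma annihilated_vector:
  fixes c :: "complex vec"
  assumes c: "c \<in> carrier_vec n" and k: "k < n" and l: "l < n"
    and le: "Re (c $ k * cnj (c $ l)) \<le> 0"
  obtains x where "x \<in> cone_plus n" "x \<noteq> 0\<^sub>v n" "c \<bullet> x = 0"
proof (cases "c $ k = 0")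
  case True
  show thesis
  proof (rule that)
    show "unit_vec n k \<in> cone_plus n"
      by (auto simp: cone_plus_def unit_vec_def)
    show "unit_vec n k \<noteq> (0\<^sub>v n :: complex vec)" using k by (simp add: unit_vec_nonzero)
    show "c \<bullet> unit_vec n k = 0" using c k True by simp
  qed
next
  case False
  then have "Re (c $ k * cnj (c $ k)) > 0"
    unfolding complex_mult_cnj by (simp add: complex_neq_0)
  then have kl: "k \<noteq> l" using le by auto
  define x where "x = vec n (\<lambda>i. if i = k then c $ l else if i = l then - c $ k else 0)"
  show thesis
  proof (rule that)
    show "x \<in> cone_plus n"
      using le kl k l by (auto simp: x_def cone_plus_def algebra_simps)
    have "x $ l \<noteq> 0" using kl l False by (simp add: x_def)
    then show "x \<noteq> 0\<^sub>v n" using l by auto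
    have summand: "c $ i * x $ i = (if i = k then c $ k * c $ l else 0) + (if i = l then - c $ l * c $ k else 0)"
      if "i < n" for i using kl that by (auto simp: x_def)
    have "dim_vec x = n" by (simp add: x_def)
    then have "c \<bullet> x = (\<Sum>i<n. (if i = k then c $ k * c $ l else 0) + (if i = l then - c $ l * c $ k else 0))"
      unfolding scalar_prod_def using summand by (simp add: lessThan_atLeast0)
    also have "\<dots> = 0" using k l by (simp add: sum.distrib)
    finally show "c \<bullet> x = 0" .
  qed
qed

lemma not_int_cone_plusE:
  assumes "v \<in> carrier_vec n" "v \<notin> int_cone_plus n"
  obtains k l where "k < n" "l < n" "Re (v $ k * cnj (v $ l)) \<le> 0"
  using assms unfolding int_cone_plus_def by (blast intro: leI)

lemma int_cone_plusD:
  assumes "x \<in> int_cone_plus n"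
  shows "x \<in> carrier_vec n" and "dim_vec x = n" and "k < n \<Longrightarrow> l < n \<Longrightarrow> Re (x $ k * cnj (x $ l)) > 0"
    and "k < n \<Longrightarrow> x $ k \<noteq> 0" and "x \<in> cone_plus n" and "0 < n \<Longrightarrow> x \<noteq> 0\<^sub>v n"
proof -
  show *: "x \<in> carrier_vec n" "dim_vec x = n" "x \<in> cone_plus n"
    using assms by (auto simp: int_cone_plus_def cone_plus_def intro: less_imp_le)
  show **: "Re (x $ k * cnj (x $ l)) > 0" if "k < n" "l < n" for k l
    using assms that by (auto simp: int_cone_plus_def)
  show ***: "x $ k \<noteq> 0" if "k < n" for k using **[OF that that] by auto
  show "x \<noteq> 0\<^sub>v n" if "0 < n" using ***[OF that] that by auto
qed

lemma scalar_prod_lin_comb: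
  fixes a b x :: "complex vec"
  assumes "a \<in> carrier_vec n" "b \<in> carrier_vec n" "x \<in> carrier_vec n"
  shows "(z \<cdot>\<^sub>v a - b) \<bullet> x = z * (a \<bullet> x) - b \<bullet> x"
  using assms by (simp add: minus_scalar_prod_distrib[of _ n])

section \<open>Ratios of two rows and the entry condition\<close>

text \<open>For \<open>s = (b \<bullet> x) / (a \<bullet> x)\<close> the functional \<open>s a - b\<close> annihilates \<open>x\<close>, hence is not in the
  interior; a violated pair of coordinates is a disc that contains \<open>s\<close>. So every value of the ratio
  on the cone is already a value on the vectors supported on two coordinates.\<close>

lemma row_ratio_mem_disc:
  assumes a: "a \<in> int_cone_plus n" and b: "b \<in> carrier_vec n"
    and x: "x \<in> cone_plus n" "x \<noteq> 0\<^sub>v n"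
  obtains p q where "p < n" "q < n"
    "cmod ((b \<bullet> x) / (a \<bullet> x) - disc_centre a b p q) \<le> disc_radius a b p q"
proof -
  define s where "s = (b \<bullet> x) / (a \<bullet> x)"
  have ac: "a \<in> carrier_vec n" by (rule int_cone_plusD(1)[OF a])
  have xc: "x \<in> carrier_vec n" using x by (simp add: cone_plus_def)
  have "(s \<cdot>\<^sub>v a - b) \<bullet> x = 0"
    unfolding scalar_prod_lin_comb[OF ac b xc] using pairing_nonzero[OF a x] by (simp add: s_def)
  then have "s \<cdot>\<^sub>v a - b \<notin> int_cone_plus n" using pairing_nonzero[OF _ x] by blast
  moreover have "s \<cdot>\<^sub>v a - b \<in> carrier_vec n" using ac b by simp
  ultimately obtain p q where pq: "p < n" "q < n"
      and le: "Re ((s \<cdot>\<^sub>v a - b) $ p * cnj ((s \<cdot>\<^sub>v a - b) $ q)) \<le> 0"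
    using not_int_cone_plusE by blast
  have "Re ((s * a $ p - b $ p) * cnj (s * a $ q - b $ q)) \<le> 0" using le ac b pq by simp
  then show thesis
    using that pq mem_disc_iff[OF int_cone_plusD(3)[OF a pq(1,2)]] unfolding s_def by blast
qed

lemma disc_point_is_row_ratio:
  assumes a: "a \<in> int_cone_plus n" and b: "b \<in> carrier_vec n" and p: "p < n" and q: "q < n"
    and z: "cmod (z - disc_centre a b p q) \<le> disc_radius a b p q"
  obtains x where "x \<in> cone_plus n" "x \<noteq> 0\<^sub>v n" "b \<bullet> x = z * (a \<bullet> x)"
proof -
  have ac: "a \<in> carrier_vec n" by (rule int_cone_plusD(1)[OF a])
  have "Re ((z * a $ p - b $ p) * cnj (z * a $ q - b $ q)) \<le> 0"
    using mem_disc_iff[OF int_cone_plusD(3)[OF a p q]] z by blast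
  then have le: "Re ((z \<cdot>\<^sub>v a - b) $ p * cnj ((z \<cdot>\<^sub>v a - b) $ q)) \<le> 0"
    using ac b p q by simp
  have car: "z \<cdot>\<^sub>v a - b \<in> carrier_vec n" using ac b by simp
  obtain x where x: "x \<in> cone_plus n" "x \<noteq> 0\<^sub>v n" "(z \<cdot>\<^sub>v a - b) \<bullet> x = 0"
    using annihilated_vector[OF car p q le] .
  have xc: "x \<in> carrier_vec n" using x by (simp add: cone_plus_def)
  show thesis using that[OF x(1,2)] x(3) unfolding scalar_prod_lin_comb[OF ac b xc] by simp
qed

text \<open>These are the values of the ratio at unit vectors: they link discs that share an index.\<close>

lemma coordinate_ratio_mem_disc:
  assumes a: "a \<in> int_cone_plus n" and p: "p < n" and q: "q < n"
  shows "cmod (b $ p / a $ p - disc_centre a b p q) \<le> disc_radius a b p q"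
    and "cmod (b $ q / a $ q - disc_centre a b p q) \<le> disc_radius a b p q"
  using int_cone_plusD(4)[OF a p] int_cone_plusD(4)[OF a q]
  by (simp_all add: mem_disc_iff[OF int_cone_plusD(3)[OF a p q], symmetric])

text \<open>A row outside the interior is annihilated by some nonzero vector of the cone, whose image then
  has a vanishing coordinate.\<close>

lemma row_mem_int_cone_plus:
  assumes A: "A \<in> carrier_mat n n"
    and M: "(\<lambda>x. A *\<^sub>v x) ` (cone_plus n - {0\<^sub>v n}) \<subseteq> int_cone_plus n" and k: "k < n"
  shows "row A k \<in> int_cone_plus n"
proof (rule ccontr)
  have rc: "row A k \<in> carrier_vec n" using A by auto
  assume "row A k \<notin> int_cone_plus n"
  then obtain p q where "p < n" "q < n" "Re (row A k $ p * cnj (row A k $ q)) \<le> 0"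
    by (rule not_int_cone_plusE[OF rc])
  from annihilated_vector[OF rc this]
  obtain x where x: "x \<in> cone_plus n" "x \<noteq> 0\<^sub>v n" "row A k \<bullet> x = 0" .
  have "A *\<^sub>v x \<in> int_cone_plus n" using M x by blast
  from int_cone_plusD(4)[OF this k] show False using A k x by simp
qed

text \<open>\<open>A\<close> maps into the interior when all row ratios have positive real part. Their values fill the
  closed discs, and such a disc lies in the open right half-plane when its radius is smaller than the
  real part of its centre.\<close>

lemma maps_cone_iff_entries:
  assumes A: "A \<in> carrier_mat n n"
  shows "(\<lambda>x. A *\<^sub>v x) ` (cone_plus n - {0\<^sub>v n}) \<subseteq> int_cone_plus n
    \<longleftrightarrow> (\<forall>k<n. \<forall>l<n. \<forall>p<n. \<forall>q<n.
          Re (cnj (A $$ (k,p)) * A $$ (l,q) + cnj (A $$ (k,q)) * A $$ (l,p))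
            > cmod (A $$ (k,p) * A $$ (l,q) - A $$ (k,q) * A $$ (l,p)))" (is "?M \<longleftrightarrow> ?E")
proof
  assume M: ?M
  note row_int = row_mem_int_cone_plus[OF A M]
  show ?E
  proof (intro allI impI)
    fix k l p q assume k: "k < n" and l: "l < n" and p: "p < n" and q: "q < n"
    let ?a = "row A k" and ?b = "row A l"
    have b: "?b \<in> carrier_vec n" using A by auto
    define \<alpha> where "\<alpha> = Re (?a $ p * cnj (?a $ q))"
    have \<alpha>: "\<alpha> > 0" unfolding \<alpha>_def by (rule int_cone_plusD(3)[OF row_int[OF k] p q])
    \<comment> \<open>the leftmost point of the disc\<close>
    define z where "z = disc_centre ?a ?b p q - complex_of_real (disc_radius ?a ?b p q)"
    have "cmod (z - disc_centre ?a ?b p q) \<le> disc_radius ?a ?b p q"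
      using disc_radius_nonneg[OF \<alpha>[unfolded \<alpha>_def], of ?b] by (simp add: z_def)
    from disc_point_is_row_ratio[OF row_int[OF k] b p q this]
    obtain x where x: "x \<in> cone_plus n" "x \<noteq> 0\<^sub>v n" "?b \<bullet> x = z * (?a \<bullet> x)" .
    have "A *\<^sub>v x \<in> int_cone_plus n" using M x by blast
    from int_cone_plusD(3)[OF this l k]
    have "Re (z * (?a \<bullet> x) * cnj (?a \<bullet> x)) > 0" using A k l x by simp
    moreover have "Re (z * (?a \<bullet> x) * cnj (?a \<bullet> x)) = Re z * (cmod (?a \<bullet> x))\<^sup>2"
      unfolding mult.assoc complex_norm_square[symmetric] by simp
    ultimately have "Re z > 0" by (metis mult_nonpos_nonneg not_less zero_le_power2)
    then have "disc_radius ?a ?b p q < Re (disc_centre ?a ?b p q)" by (simp add: z_def)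
    then have "cmod (?a $ p * ?b $ q - ?a $ q * ?b $ p) < Re (cnj (?a $ p) * ?b $ q + cnj (?a $ q) * ?b $ p)"
      using \<alpha> unfolding disc_radius_def disc_centre_def \<alpha>_def[symmetric] Re_divide_of_real
      by (simp add: divide_less_cancel)
    then show "Re (cnj (A $$ (k,p)) * A $$ (l,q) + cnj (A $$ (k,q)) * A $$ (l,p))
            > cmod (A $$ (k,p) * A $$ (l,q) - A $$ (k,q) * A $$ (l,p))"
      using A k l p q by simp
  qed
next
  assume E: ?E
  have row_int: "row A k \<in> int_cone_plus n" if k: "k < n" for k
  proof -
    have "Re (A $$ (k,p) * cnj (A $$ (k,q))) > 0" if "p < n" "q < n" for p q
      using E[rule_format, OF k k that] by (simp add: mult.commute)
    then show ?thesis using A k by (auto simp: int_cone_plus_def)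
  qed
  show ?M
  proof (intro image_subsetI)
    fix x assume "x \<in> cone_plus n - {0\<^sub>v n}"
    then have x: "x \<in> cone_plus n" "x \<noteq> 0\<^sub>v n" by auto
    have "Re ((row A l \<bullet> x) * cnj (row A k \<bullet> x)) > 0" if k: "k < n" and l: "l < n" for k l
    proof -
      let ?a = "row A k" and ?b = "row A l"
      have b: "?b \<in> carrier_vec n" using A by auto
      define s where "s = (?b \<bullet> x) / (?a \<bullet> x)"
      have ax: "?a \<bullet> x \<noteq> 0" by (rule pairing_nonzero[OF row_int[OF k] x])
      from row_ratio_mem_disc[OF row_int[OF k] b x] obtain p q where p: "p < n" and q: "q < n"
        and d: "cmod (s - disc_centre ?a ?b p q) \<le> disc_radius ?a ?b p q" unfolding s_def .
      have \<alpha>: "Re (?a $ p * cnj (?a $ q)) > 0" by (rule int_cone_plusD(3)[OF row_int[OF k] p q])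
      have "cmod (?a $ p * ?b $ q - ?a $ q * ?b $ p) < Re (cnj (?a $ p) * ?b $ q + cnj (?a $ q) * ?b $ p)"
        using E[rule_format, OF k l p q] A k l p q by simp
      then have "disc_radius ?a ?b p q < Re (disc_centre ?a ?b p q)"
        using \<alpha> unfolding disc_radius_def disc_centre_def Re_divide_of_real
        by (simp add: divide_less_cancel)
      then have "Re s > 0" using d abs_Re_le_cmod[of "s - disc_centre ?a ?b p q"] by simp
      moreover have "(?b \<bullet> x) * cnj (?a \<bullet> x) = s * of_real ((cmod (?a \<bullet> x))\<^sup>2)"
        unfolding complex_norm_square using ax by (simp add: s_def)
      ultimately show ?thesis using ax by simp
    qed
    moreover have "A *\<^sub>v x \<in> carrier_vec n" using A x by (auto simp: cone_plus_def)
    ultimately show "A *\<^sub>v x \<in> int_cone_plus n" using A by (simp add: int_cone_plus_def)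
  qed
qed

section \<open>Distortion of a pencil of two rows\<close>

text \<open>A disc that is narrow as seen from the left half-plane: for \<open>Re \<zeta> \<ge> 0\<close> the point \<open>- 1 / \<zeta>\<close> has
  distance at least \<open>Re c\<close> from the centre \<open>c\<close>, while the radius is at most \<open>\<theta> Re c\<close>. So the
  distances from that point to two points of the disc differ at most by the factor
  \<open>(1 + \<theta>) / (1 - \<theta>)\<close>. Writing \<open>1 + \<zeta> s\<close> instead of \<open>s + 1 / \<zeta>\<close> includes \<open>\<zeta> = 0\<close>; the first claim is
  the limit \<open>\<zeta> = \<infinity>\<close>.\<close>

lemma pencil_comparison:
  fixes c s s' \<zeta> :: complex and r \<theta> :: real
  assumes \<theta>: "0 \<le> \<theta>" "\<theta> < 1" and r: "r \<le> \<theta> * Re c" and s: "cmod (s - c) \<le> r" and s': "cmod (s' - c) \<le> r"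
  shows "cmod s \<le> (1 + \<theta>) / (1 - \<theta>) * cmod s'"
    and "Re \<zeta> \<ge> 0 \<Longrightarrow> cmod (1 + \<zeta> * s) \<le> (1 + \<theta>) / (1 - \<theta>) * cmod (1 + \<zeta> * s')"
proof -
  have key: "cmod (v + u * s) \<le> (1 + \<theta>) / (1 - \<theta>) * cmod (v + u * s')"
    if m: "cmod u * Re c \<le> cmod (v + u * c)" for u v
  proof -
    have near: "cmod ((v + u * w) - (v + u * c)) \<le> \<theta> * cmod (v + u * c)" if w: "cmod (w - c) \<le> r" for w
    proof -
      have "cmod ((v + u * w) - (v + u * c)) = cmod u * cmod (w - c)"
        by (simp add: norm_mult[symmetric] algebra_simps)
      also have "\<dots> \<le> cmod u * (\<theta> * Re c)"
        using w r by (intro mult_left_mono) auto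
      also have "\<dots> = \<theta> * (cmod u * Re c)" by simp
      also have "\<dots> \<le> \<theta> * cmod (v + u * c)" using m \<theta> by (intro mult_left_mono) auto
      finally show ?thesis .
    qed
    have up: "cmod (v + u * s) \<le> (1 + \<theta>) * cmod (v + u * c)"
      using near[OF s] norm_triangle_sub[of "v + u * s" "v + u * c"] by (simp add: algebra_simps)
    have lo: "(1 - \<theta>) * cmod (v + u * c) \<le> cmod (v + u * s')"
      using near[OF s'] norm_triangle_sub[of "v + u * c" "v + u * s'"]
      by (simp add: algebra_simps norm_minus_commute)
    have "(1 + \<theta>) * cmod (v + u * c) = (1 + \<theta>) / (1 - \<theta>) * ((1 - \<theta>) * cmod (v + u * c))"
      using \<theta> by simp
    also have "\<dots> \<le> (1 + \<theta>) / (1 - \<theta>) * cmod (v + u * s')"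
      using lo \<theta> by (intro mult_left_mono) auto
    finally show ?thesis using up by linarith
  qed
  show "cmod s \<le> (1 + \<theta>) / (1 - \<theta>) * cmod s'"
    using key[of 1 0] complex_Re_le_cmod[of c] by simp
  assume \<zeta>: "Re \<zeta> \<ge> 0"
  have "cmod \<zeta> * Re c \<le> cmod (1 + \<zeta> * c)"
  proof (cases "\<zeta> = 0")
    case False
    have "cnj \<zeta> * (1 + \<zeta> * c) = cnj \<zeta> + of_real ((cmod \<zeta>)\<^sup>2) * c"
      unfolding complex_norm_square by (simp add: algebra_simps)
    then have "Re (cnj \<zeta> * (1 + \<zeta> * c)) = Re \<zeta> + (cmod \<zeta>)\<^sup>2 * Re c" by simp
    then have "(cmod \<zeta>)\<^sup>2 * Re c \<le> cmod (cnj \<zeta> * (1 + \<zeta> * c))"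
      using complex_Re_le_cmod[of "cnj \<zeta> * (1 + \<zeta> * c)"] \<zeta> by linarith
    then have "cmod \<zeta> * (cmod \<zeta> * Re c) \<le> cmod \<zeta> * cmod (1 + \<zeta> * c)"
      by (simp add: norm_mult power2_eq_square mult.assoc)
    then show ?thesis using False by (simp add: mult_le_cancel_left)
  qed simp
  then show "cmod (1 + \<zeta> * s) \<le> (1 + \<theta>) / (1 - \<theta>) * cmod (1 + \<zeta> * s')" by (rule key)
qed

text \<open>The row ratios at \<open>x\<close> and \<open>y\<close> lie in discs \<open>(p, p')\<close> and \<open>(q, q')\<close>. The ratios at the unit
  vectors \<open>p\<close> and \<open>q\<close> lie in these discs and in the disc \<open>(p, q)\<close>, so three comparisons inside one
  disc lead from \<open>x\<close> to \<open>y\<close>. For moduli, the comparison in the middle can be replaced by a direct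
  bound \<open>M\<close> on the ratios at unit vectors.\<close>

lemma pencil_distortion:
  assumes a: "a \<in> int_cone_plus n" and b: "b \<in> carrier_vec n" and \<theta>: "0 \<le> \<theta>" "\<theta> < 1"
    and narrow: "\<And>p q. p < n \<Longrightarrow> q < n \<Longrightarrow> disc_radius a b p q \<le> \<theta> * Re (disc_centre a b p q)"
    and x: "x \<in> cone_plus n" "x \<noteq> 0\<^sub>v n" and y: "y \<in> cone_plus n" "y \<noteq> 0\<^sub>v n"
  defines "K \<equiv> (1 + \<theta>) / (1 - \<theta>)"
  shows "Re \<zeta> \<ge> 0 \<Longrightarrow> cmod (1 + \<zeta> * ((b \<bullet> y) / (a \<bullet> y))) \<le> K ^ 3 * cmod (1 + \<zeta> * ((b \<bullet> x) / (a \<bullet> x)))"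
    and "(\<And>p q. p < n \<Longrightarrow> q < n \<Longrightarrow> cmod (b $ p / a $ p) \<le> M * cmod (b $ q / a $ q)) \<Longrightarrow> M \<ge> 0 \<Longrightarrow>
      cmod ((b \<bullet> y) / (a \<bullet> y)) \<le> K ^ 2 * M * cmod ((b \<bullet> x) / (a \<bullet> x))"
proof -
  define s where "s = (b \<bullet> x) / (a \<bullet> x)"
  define s' where "s' = (b \<bullet> y) / (a \<bullet> y)"
  define t where "t p = b $ p / a $ p" for p
  have K: "K \<ge> 0" using \<theta> by (simp add: K_def)
  obtain p p' where p: "p < n" "p' < n" "cmod (s - disc_centre a b p p') \<le> disc_radius a b p p'"
    unfolding s_def by (rule row_ratio_mem_disc[OF a b x])
  obtain q q' where q: "q < n" "q' < n" "cmod (s' - disc_centre a b q q') \<le> disc_radius a b q q'"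
    unfolding s'_def by (rule row_ratio_mem_disc[OF a b y])
  have tp: "cmod (t p - disc_centre a b p p') \<le> disc_radius a b p p'"
    and tp': "cmod (t p - disc_centre a b p q) \<le> disc_radius a b p q"
    and tq: "cmod (t q - disc_centre a b q q') \<le> disc_radius a b q q'"
    and tq': "cmod (t q - disc_centre a b p q) \<le> disc_radius a b p q"
    unfolding t_def using coordinate_ratio_mem_disc[OF a] p(1,2) q(1,2) by blast+
  note pc = pencil_comparison[OF \<theta> narrow, folded K_def]
  show "cmod (1 + \<zeta> * s') \<le> K ^ 3 * cmod (1 + \<zeta> * s)" if \<zeta>: "Re \<zeta> \<ge> 0"
  proof -
    have "cmod (1 + \<zeta> * s') \<le> K * cmod (1 + \<zeta> * t q)"
      by (rule pc(2)[OF q tq \<zeta>])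
    also have "\<dots> \<le> K * (K * cmod (1 + \<zeta> * t p))"
      by (intro mult_left_mono K pc(2)[OF p(1) q(1) tq' tp' \<zeta>])
    also have "\<dots> \<le> K * (K * (K * cmod (1 + \<zeta> * s)))"
      by (intro mult_left_mono K pc(2)[OF p(1,2) tp p(3) \<zeta>])
    finally show ?thesis by (simp add: power3_eq_cube mult.assoc)
  qed
  show "cmod s' \<le> K ^ 2 * M * cmod s"
    if M: "\<And>p q. p < n \<Longrightarrow> q < n \<Longrightarrow> cmod (b $ p / a $ p) \<le> M * cmod (b $ q / a $ q)" "M \<ge> 0"
  proof -
    have "cmod s' \<le> K * cmod (t q)" by (rule pc(1)[OF q tq])
    also have "\<dots> \<le> K * (M * cmod (t p))"
      unfolding t_def by (intro mult_left_mono K M p q)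
    also have "\<dots> \<le> K * (M * (K * cmod s))"
      by (intro mult_left_mono K M pc(1)[OF p(1,2) tp p(3)])
    finally show ?thesis by (simp add: power2_eq_square mult_ac)
  qed
qed

section \<open>The projective metric and the diameter bound\<close>

lemma proj_metric_le:
  assumes ncol: "\<not> colinear x y" and Q: "Q > 0"
    and z0: "z0 \<in> E_set C x y" "z0 \<noteq> 0"
    and ratio: "\<And>z z'. z \<in> E_set C x y \<Longrightarrow> z' \<in> E_set C x y \<Longrightarrow> cmod z \<le> Q * cmod z'"
  shows "proj_metric C x y \<le> ereal (ln Q)"
proof -
  define b where "b = (SUP z\<in>E_set C x y. ereal (cmod z))"
  define a where "a = (INF z\<in>E_set C x y. ereal (cmod z))"
  have b_le: "b \<le> ereal (Q * cmod z)" if "z \<in> E_set C x y" for z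
    unfolding b_def using ratio that by (intro SUP_least) simp
  have "ereal (cmod z0) \<le> b" unfolding b_def by (rule SUP_upper[OF z0(1)])
  then obtain br where br: "b = ereal br" "cmod z0 \<le> br" "br \<le> Q * cmod z0"
    using b_le[OF z0(1)] by (cases b) auto
  have "ereal (br / Q) \<le> a" unfolding a_def
    using b_le br Q by (intro INF_greatest) (simp add: field_simps)
  moreover have "a \<le> ereal (cmod z0)" unfolding a_def by (rule INF_lower[OF z0(1)])
  ultimately obtain ar where ar: "a = ereal ar" "br / Q \<le> ar" by (cases a) auto
  have brpos: "br > 0" using br z0 by (meson less_le_trans zero_less_norm_iff)
  then have arpos: "ar > 0" using ar Q by (meson divide_pos_pos less_le_trans)
  have "br / ar \<le> Q" using ar arpos Q by (simp add: field_simps)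
  then have "ln (br / ar) \<le> ln Q" using brpos arpos Q by simp
  moreover have "proj_metric C x y = ereal (ln (br / ar))"
    unfolding proj_metric_def Let_def b_def[symmetric] a_def[symmetric]
    using ncol br ar arpos by simp
  ultimately show ?thesis by simp
qed

lemma proj_metric_leD:
  assumes le: "proj_metric C x y \<le> ereal D" and ncol: "\<not> colinear x y"
    and z: "z \<in> E_set C x y" and z': "z' \<in> E_set C x y"
  shows "cmod z \<le> exp D * cmod z'"
proof -
  define b where "b = (SUP z\<in>E_set C x y. ereal (cmod z))"
  define a where "a = (INF z\<in>E_set C x y. ereal (cmod z))"
  have fin: "b \<noteq> \<infinity>" "a \<noteq> 0"
    and ln_le: "ereal (ln (real_of_ereal b / real_of_ereal a)) \<le> ereal D"
    using le ncol unfolding proj_metric_def Let_def b_def[symmetric] a_def[symmetric]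
    by (auto split: if_splits)
  have zb: "ereal (cmod z) \<le> b" and zb': "ereal (cmod z') \<le> b"
    unfolding b_def by (auto intro: SUP_upper z z')
  then obtain br where br: "b = ereal br" using fin by (cases b) auto
  have az': "a \<le> ereal (cmod z')" unfolding a_def by (rule INF_lower[OF z'])
  have "0 \<le> a" unfolding a_def by (intro INF_greatest) simp
  then obtain ar where ar: "a = ereal ar" "ar > 0" using az' fin by (cases a) auto
  have "ar \<le> cmod z'" "cmod z' \<le> br" "cmod z \<le> br" using az' ar zb zb' br by auto
  then have "br > 0" using ar by linarith
  then have "br / ar = exp (ln (br / ar))" using ar by simp
  also have "\<dots> \<le> exp D" using ln_le ar br by simp
  finally have "br / ar \<le> exp D" .
  then have "br \<le> exp D * ar" using ar by (simp add: field_simps)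
  also have "\<dots> \<le> exp D * cmod z'" using \<open>ar \<le> cmod z'\<close> by simp
  finally show ?thesis using \<open>cmod z \<le> br\<close> by linarith
qed

lemma colinear_iff_multiple:
  assumes x: "x \<in> int_cone_plus n" and y: "y \<in> carrier_vec n" and n: "0 < n"
  shows "colinear x y \<longleftrightarrow> (\<exists>\<gamma>. y = \<gamma> \<cdot>\<^sub>v x)"
proof
  have xc: "dim_vec x = n" and xn: "\<And>k. k < n \<Longrightarrow> x $ k \<noteq> 0" using int_cone_plusD[OF x] by auto
  assume "colinear x y"
  then obtain \<alpha> \<beta> where ab: "\<alpha> \<noteq> 0 \<or> \<beta> \<noteq> 0" "\<alpha> \<cdot>\<^sub>v x + \<beta> \<cdot>\<^sub>v y = 0\<^sub>v n"
    unfolding colinear_def xc by auto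
  have co: "\<alpha> * x $ k + \<beta> * y $ k = 0" if k: "k < n" for k
    using arg_cong[OF ab(2), of "\<lambda>v. v $ k"] k xc y by simp
  have \<beta>: "\<beta> \<noteq> 0" using co[OF n] xn[OF n] ab(1) by auto
  have "y = (- \<alpha> / \<beta>) \<cdot>\<^sub>v x"
  proof (rule eq_vecI)
    fix k assume "k < dim_vec ((- \<alpha> / \<beta>) \<cdot>\<^sub>v x)"
    then have k: "k < n" using xc by simp
    show "y $ k = ((- \<alpha> / \<beta>) \<cdot>\<^sub>v x) $ k"
      using co[OF k] \<beta> k xc by (simp add: field_simps add_eq_0_iff)
  qed (use xc y in auto)
  then show "\<exists>\<gamma>. y = \<gamma> \<cdot>\<^sub>v x" by blast
next
  assume "\<exists>\<gamma>. y = \<gamma> \<cdot>\<^sub>v x"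
  then obtain \<gamma> where "y = \<gamma> \<cdot>\<^sub>v x" by blast
  then have "\<gamma> \<cdot>\<^sub>v x + (- 1) \<cdot>\<^sub>v y = 0\<^sub>v (dim_vec x)" by auto
  then show "colinear x y" unfolding colinear_def by (metis neg_equal_0_iff_equal one_neq_zero)
qed

lemma mem_E_set_iff:
  assumes "x \<in> int_cone_plus n" "y \<in> carrier_vec n"
  shows "z \<in> E_set (cone_plus n) x y \<longleftrightarrow>
    (\<exists>k<n. \<exists>l<n. Re ((z * x $ k - y $ k) * cnj (z * x $ l - y $ l)) < 0)"
proof -
  have "z \<cdot>\<^sub>v x - y \<in> carrier_vec n" using assms int_cone_plusD(1) by auto
  then have "z \<in> E_set (cone_plus n) x y \<longleftrightarrow>
      (\<exists>k<n. \<exists>l<n. Re ((z \<cdot>\<^sub>v x - y) $ k * cnj ((z \<cdot>\<^sub>v x - y) $ l)) < 0)"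
    unfolding E_set_def cone_plus_def mem_Collect_eq by (auto simp del: index_minus_vec simp: not_le)
  also have "\<dots> \<longleftrightarrow> (\<exists>k<n. \<exists>l<n. Re ((z * x $ k - y $ k) * cnj (z * x $ l - y $ l)) < 0)"
    using assms int_cone_plusD(2)[OF assms(1)]
    by (intro arg_cong[where f=Ex] ext conj_cong refl) auto
  finally show ?thesis .
qed

lemma distinct_ratios:
  assumes x: "x \<in> int_cone_plus n" and y: "y \<in> carrier_vec n" and n: "0 < n"
    and ncol: "\<not> colinear x y" and k: "k < n"
  obtains m where "m < n" "y $ m / x $ m \<noteq> y $ k / x $ k"
proof -
  have xc: "dim_vec x = n" and xn: "\<And>k. k < n \<Longrightarrow> x $ k \<noteq> 0" using int_cone_plusD[OF x] by auto
  have "y \<noteq> (y $ k / x $ k) \<cdot>\<^sub>v x" using ncol colinear_iff_multiple[OF x y n] by blast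
  then obtain m where m: "m < n" "y $ m \<noteq> y $ k / x $ k * x $ m"
    using y xc by (metis carrier_vecD eq_vecI index_smult_vec(1) index_smult_vec(2))
  show thesis using that[OF m(1)] m(2) xn[OF m(1)] by (metis nonzero_divide_eq_eq)
qed

lemma disc_radius_pos:
  assumes x: "x \<in> int_cone_plus n" and k: "k < n" and l: "l < n"
    and ne: "y $ k / x $ k \<noteq> y $ l / x $ l"
  shows "disc_radius x y k l > 0"
proof -
  have "x $ k * y $ l - x $ l * y $ k \<noteq> 0"
    using ne int_cone_plusD(4)[OF x] k l by (auto simp: field_simps)
  then show ?thesis using int_cone_plusD(3)[OF x k l] by (simp add: disc_radius_def)
qed

lemma E_set_nonempty:
  assumes x: "x \<in> int_cone_plus n" and y: "y \<in> carrier_vec n" and n: "0 < n"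
    and ncol: "\<not> colinear x y"
  obtains z where "z \<in> E_set (cone_plus n) x y"
proof -
  obtain m where m: "m < n" "y $ m / x $ m \<noteq> y $ 0 / x $ 0"
    using distinct_ratios[OF x y n ncol n] .
  have "disc_radius x y m 0 > 0" by (rule disc_radius_pos[OF x m(1) n m(2)])
  then have "Re ((z * x $ m - y $ m) * cnj (z * x $ 0 - y $ 0)) < 0" if "z = disc_centre x y m 0" for z
    using mem_open_disc_iff[OF int_cone_plusD(3)[OF x m(1) n]] that by simp
  then show thesis using that mem_E_set_iff[OF x y] m(1) n by blast
qed

text \<open>A point \<open>z\<close> of the set \<open>E\<close> of two image vectors \<open>X\<close>, \<open>Y\<close> satisfies
  \<open>z (X\<^sub>k + \<zeta> X\<^sub>l) = Y\<^sub>k + \<zeta> Y\<^sub>l\<close> for two rows \<open>k\<close>, \<open>l\<close> and some \<open>\<zeta>\<close> with \<open>Re \<zeta> \<ge> 0\<close>. Distortion in the pencil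
  of these rows puts \<open>|z|\<close> within a factor \<open>K ^ 3\<close> of \<open>|Y\<^sub>k / X\<^sub>k|\<close>, where \<open>K = (1 + \<theta>) / (1 - \<theta>)\<close>.
  Passing from row \<open>k\<close> to the row that belongs to a second point costs \<open>K\<^sup>2 \<sigma>\<^sup>2\<close>. In total two
  points of \<open>E\<close> differ in modulus at most by the factor \<open>K ^ 8 \<sigma>\<^sup>2\<close>.\<close>

lemma image_diameter_le:
  assumes n: "0 < n" and A: "A \<in> carrier_mat n n" and \<theta>: "0 < \<theta>" "\<theta> < 1" and \<sigma>: "\<sigma> > 1"
    and E: "\<forall>k<n. \<forall>l<n. \<forall>p<n. \<forall>q<n.
              Re (cnj (A $$ (k,p)) * A $$ (l,q) + cnj (A $$ (k,q)) * A $$ (l,p))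
                > 1 / \<theta> * cmod (A $$ (k,p) * A $$ (l,q) - A $$ (k,q) * A $$ (l,p))
            \<and> cmod (A $$ (k,p) * A $$ (l,q)) \<le> \<sigma>\<^sup>2 * cmod (A $$ (k,q) * A $$ (l,p))"
  shows "image_diameter n A \<le> ereal (8 * ln ((1 + \<theta>) / (1 - \<theta>)) + 2 * ln \<sigma>)"
proof -
  have \<theta>': "0 \<le> \<theta>" "\<theta> < 1" using \<theta> by simp_all
  define K where "K = (1 + \<theta>) / (1 - \<theta>)"
  have K: "K \<ge> 1" "K > 0" using \<theta> by (auto simp: K_def field_simps)
  define Q where "Q = K ^ 8 * \<sigma>\<^sup>2"
  have "1 * 1 \<le> K ^ 8 * \<sigma>\<^sup>2" using K \<sigma> by (intro mult_mono one_le_power) auto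
  then have Q: "Q \<ge> 1" "Q > 0" by (auto simp: Q_def)
  have lnQ: "ln Q = 8 * ln K + 2 * ln \<sigma>" unfolding Q_def using K \<sigma> by (simp add: ln_mult ln_realpow)
  have strict: "Re (cnj (A $$ (k,p)) * A $$ (l,q) + cnj (A $$ (k,q)) * A $$ (l,p))
            > cmod (A $$ (k,p) * A $$ (l,q) - A $$ (k,q) * A $$ (l,p))"
    if "k < n" "l < n" "p < n" "q < n" for k l p q
  proof -
    have "cmod w \<le> 1 / \<theta> * cmod w" for w
      using \<theta> mult_right_mono[of \<theta> 1 "cmod w"] by (simp add: field_simps)
    then show ?thesis using E that by (meson le_less_trans)
  qed
  then have M: "(\<lambda>x. A *\<^sub>v x) ` (cone_plus n - {0\<^sub>v n}) \<subseteq> int_cone_plus n"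
    using maps_cone_iff_entries[OF A] by blast
  note row_int = row_mem_int_cone_plus[OF A M]
  have rowc: "row A l \<in> carrier_vec n" for l using A by auto
  have narrow: "disc_radius (row A k) (row A l) p q \<le> \<theta> * Re (disc_centre (row A k) (row A l) p q)"
    if k: "k < n" and l: "l < n" and p: "p < n" and q: "q < n" for k l p q
  proof -
    let ?a = "row A k" and ?b = "row A l"
    have \<alpha>: "Re (?a $ p * cnj (?a $ q)) > 0" by (rule int_cone_plusD(3)[OF row_int[OF k] p q])
    have "1 / \<theta> * cmod (?a $ p * ?b $ q - ?a $ q * ?b $ p) < Re (cnj (?a $ p) * ?b $ q + cnj (?a $ q) * ?b $ p)"
      using E A k l p q by simp
    then have "cmod (?a $ p * ?b $ q - ?a $ q * ?b $ p) \<le> \<theta> * Re (cnj (?a $ p) * ?b $ q + cnj (?a $ q) * ?b $ p)"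
      using \<theta> by (simp add: field_simps)
    then show ?thesis
      using \<alpha> unfolding disc_radius_def disc_centre_def Re_divide_of_real times_divide_eq_right
      by (intro divide_right_mono) auto
  qed
  have ratio: "cmod (row A l $ p / row A k $ p) \<le> \<sigma>\<^sup>2 * cmod (row A l $ q / row A k $ q)"
    if k: "k < n" and l: "l < n" and p: "p < n" and q: "q < n" for k l p q
  proof -
    have "cmod (A $$ (k,q) * A $$ (l,p)) \<le> \<sigma>\<^sup>2 * cmod (A $$ (k,p) * A $$ (l,q))" using E k l p q by blast
    then show ?thesis
      using int_cone_plusD(4)[OF row_int[OF k] p] int_cone_plusD(4)[OF row_int[OF k] q] A k l p q
      by (simp add: norm_divide norm_mult field_simps)
  qed
  have "proj_metric (cone_plus n) (A *\<^sub>v x) (A *\<^sub>v y) \<le> ereal (ln Q)"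
    if x: "x \<in> cone_plus n" "x \<noteq> 0\<^sub>v n" and y: "y \<in> cone_plus n" "y \<noteq> 0\<^sub>v n" for x y
  proof (cases "colinear (A *\<^sub>v x) (A *\<^sub>v y)")
    case True
    then show ?thesis using Q by (simp add: proj_metric_def)
  next
    case ncol: False
    define X where "X = A *\<^sub>v x"
    define Y where "Y = A *\<^sub>v y"
    have X: "X \<in> int_cone_plus n" and Y: "Y \<in> int_cone_plus n" using M x y by (auto simp: X_def Y_def)
    have Xk: "X $ k = row A k \<bullet> x" "Y $ k = row A k \<bullet> y" if "k < n" for k
      using A that by (auto simp: X_def Y_def)
    define \<tau> where "\<tau> k = cmod (Y $ k / X $ k)" for k
    have \<tau>: "\<tau> k > 0" if "k < n" for k
      using int_cone_plusD(4)[OF X that] int_cone_plusD(4)[OF Y that] by (simp add: \<tau>_def)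
    have \<tau>_comp: "\<tau> k \<le> K\<^sup>2 * \<sigma>\<^sup>2 * \<tau> m" if k: "k < n" and m: "m < n" for k m
    proof -
      have "cmod (Y $ k / Y $ m) \<le> K\<^sup>2 * \<sigma>\<^sup>2 * cmod (X $ k / X $ m)"
        unfolding Xk[OF k] Xk[OF m] K_def
        by (rule pencil_distortion(2)[OF row_int[OF m] rowc \<theta>' narrow[OF m k] x y ratio[OF m k]]) auto
      then show ?thesis
        using int_cone_plusD(4)[OF X k] int_cone_plusD(4)[OF X m] int_cone_plusD(4)[OF Y m]
        by (simp add: \<tau>_def norm_divide field_simps)
    qed
    have E_bounds: "\<exists>k<n. cmod z \<le> K ^ 3 * \<tau> k \<and> \<tau> k \<le> K ^ 3 * cmod z"
      if z: "z \<in> E_set (cone_plus n) X Y" for z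
    proof -
      obtain k l where k: "k < n" and l: "l < n"
        and neg: "Re ((z * X $ k - Y $ k) * cnj (z * X $ l - Y $ l)) < 0"
        using z mem_E_set_iff[OF X int_cone_plusD(1)[OF Y]] by blast
      define u where "u = z * X $ k - Y $ k"
      define v where "v = z * X $ l - Y $ l"
      have v0: "v \<noteq> 0" using neg unfolding v_def[symmetric] by auto
      define \<zeta> where "\<zeta> = - u / v"
      have "Re (u / v) \<le> 0" using neg by (simp add: u_def v_def Re_complex_div_le_0)
      then have \<zeta>: "Re \<zeta> \<ge> 0" by (simp add: \<zeta>_def)
      have "u + \<zeta> * v = 0" using v0 by (simp add: \<zeta>_def)
      then have eq: "z * (X $ k + \<zeta> * X $ l) = Y $ k + \<zeta> * Y $ l"
        by (simp add: u_def v_def algebra_simps)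
      define sx where "sx = X $ l / X $ k"
      define sy where "sy = Y $ l / Y $ k"
      have Xk0: "X $ k \<noteq> 0" and Yk0: "Y $ k \<noteq> 0"
        using int_cone_plusD(4)[OF X k] int_cone_plusD(4)[OF Y k] by auto
      have eq': "z * (1 + \<zeta> * sx) = Y $ k / X $ k * (1 + \<zeta> * sy)"
        using eq Xk0 Yk0 by (simp add: sx_def sy_def field_simps)
      have yx: "cmod (1 + \<zeta> * sy) \<le> K ^ 3 * cmod (1 + \<zeta> * sx)"
        and xy: "cmod (1 + \<zeta> * sx) \<le> K ^ 3 * cmod (1 + \<zeta> * sy)"
        unfolding sx_def sy_def Xk[OF k] Xk[OF l] K_def
        by (rule pencil_distortion(1)[OF row_int[OF k] rowc \<theta>' narrow[OF k l] x y \<zeta>],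
            assumption, assumption)
           (rule pencil_distortion(1)[OF row_int[OF k] rowc \<theta>' narrow[OF k l] y x \<zeta>])
      have norm_eq: "cmod z * cmod (1 + \<zeta> * sx) = \<tau> k * cmod (1 + \<zeta> * sy)"
        unfolding \<tau>_def norm_mult[symmetric] eq' ..
      have pos: "cmod (1 + \<zeta> * sx) > 0"
      proof (rule ccontr)
        assume "\<not> ?thesis"
        then have "X $ k = - \<zeta> * X $ l" using Xk0 by (simp add: sx_def field_simps add_eq_0_iff)
        then have "X $ k * cnj (X $ l) = - \<zeta> * of_real ((cmod (X $ l))\<^sup>2)"
          unfolding complex_norm_square by simp
        then have "Re (X $ k * cnj (X $ l)) = - Re \<zeta> * (cmod (X $ l))\<^sup>2" by simp
        also have "\<dots> \<le> 0" using \<zeta> by (simp add: mult_nonneg_nonneg)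
        finally show False using int_cone_plusD(3)[OF X k l] by simp
      qed
      have posy: "cmod (1 + \<zeta> * sy) > 0"
        using xy pos K by (metis mult_zero_right not_less order_less_le_trans zero_less_norm_iff norm_ge_zero order_le_less)
      have "cmod z * cmod (1 + \<zeta> * sx) \<le> (K ^ 3 * \<tau> k) * cmod (1 + \<zeta> * sx)"
        unfolding norm_eq using mult_left_mono[OF yx, of "\<tau> k"] \<tau>[OF k] by (simp add: mult_ac)
      then have 1: "cmod z \<le> K ^ 3 * \<tau> k" using pos by simp
      have "\<tau> k * cmod (1 + \<zeta> * sy) \<le> (K ^ 3 * cmod z) * cmod (1 + \<zeta> * sy)"
        unfolding norm_eq[symmetric] using mult_left_mono[OF xy, of "cmod z"] by (simp add: mult_ac)
      then have 2: "\<tau> k \<le> K ^ 3 * cmod z" using posy by simp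
      show ?thesis using k 1 2 by blast
    qed
    obtain z0 where z0: "z0 \<in> E_set (cone_plus n) X Y"
      using E_set_nonempty[OF X int_cone_plusD(1)[OF Y] n] ncol unfolding X_def Y_def by blast
    have "z0 \<noteq> 0"
    proof
      assume "z0 = 0"
      with E_bounds[OF z0] obtain k where "k < n" "\<tau> k \<le> 0" by auto
      with \<tau> show False by force
    qed
    moreover have "cmod z \<le> Q * cmod z'"
      if z: "z \<in> E_set (cone_plus n) X Y" and z': "z' \<in> E_set (cone_plus n) X Y" for z z'
    proof -
      obtain k where k: "k < n" "cmod z \<le> K ^ 3 * \<tau> k" using E_bounds[OF z] by blast
      obtain m where m: "m < n" "\<tau> m \<le> K ^ 3 * cmod z'" using E_bounds[OF z'] by blast
      have "cmod z \<le> K ^ 3 * \<tau> k" by fact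
      also have "\<dots> \<le> K ^ 3 * (K\<^sup>2 * \<sigma>\<^sup>2 * \<tau> m)"
        using K by (intro mult_left_mono \<tau>_comp k m) auto
      also have "\<dots> \<le> K ^ 3 * (K\<^sup>2 * \<sigma>\<^sup>2 * (K ^ 3 * cmod z'))"
        using K by (intro mult_left_mono m) auto
      also have "\<dots> = Q * cmod z'" by (simp add: Q_def power_add[symmetric] mult_ac flip: power_add)
      finally show ?thesis .
    qed
    ultimately show ?thesis
      unfolding X_def[symmetric] Y_def[symmetric]
      using z0 ncol Q by (intro proj_metric_le) (auto simp: X_def Y_def)
  qed
  then show ?thesis
    unfolding image_diameter_def K_def[symmetric] lnQ[symmetric] by (intro SUP_least) auto
qed

section \<open>Contraction of Euclidean diameters\<close>

text \<open>The variant of \<open>E_set\<close> taken with respect to the interior. It contains the coordinate ratios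
  \<open>y\<^sub>k / x\<^sub>k\<close> even when \<open>x\<close> and \<open>y\<close> are colinear, and it shrinks under \<open>A\<close>, which makes it fit for
  iteration.\<close>

definition closed_E :: "nat \<Rightarrow> complex vec \<Rightarrow> complex vec \<Rightarrow> complex set" where
  "closed_E n x y = {z. z \<cdot>\<^sub>v x - y \<notin> int_cone_plus n}"

lemma mem_closed_E_iff:
  assumes "x \<in> int_cone_plus n" "y \<in> carrier_vec n"
  shows "z \<in> closed_E n x y \<longleftrightarrow>
    (\<exists>k<n. \<exists>l<n. Re ((z * x $ k - y $ k) * cnj (z * x $ l - y $ l)) \<le> 0)"
proof -
  have "z \<cdot>\<^sub>v x - y \<in> carrier_vec n" using assms int_cone_plusD(1) by auto
  then have "z \<in> closed_E n x y \<longleftrightarrow>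
      (\<exists>k<n. \<exists>l<n. Re ((z \<cdot>\<^sub>v x - y) $ k * cnj ((z \<cdot>\<^sub>v x - y) $ l)) \<le> 0)"
    unfolding closed_E_def int_cone_plus_def mem_Collect_eq by (auto simp del: index_minus_vec simp: not_less)
  also have "\<dots> \<longleftrightarrow> (\<exists>k<n. \<exists>l<n. Re ((z * x $ k - y $ k) * cnj (z * x $ l - y $ l)) \<le> 0)"
    using assms int_cone_plusD(2)[OF assms(1)]
    by (intro arg_cong[where f=Ex] ext conj_cong refl) auto
  finally show ?thesis .
qed

lemma ratio_mem_closed_E:
  assumes x: "x \<in> int_cone_plus n" and y: "y \<in> carrier_vec n" and k: "k < n"
  shows "y $ k / x $ k \<in> closed_E n x y"
  unfolding mem_closed_E_iff[OF x y] using int_cone_plusD(4)[OF x k] k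
  by (intro exI[of _ k] conjI) simp_all

lemma discs_bounded:
  assumes x: "x \<in> int_cone_plus n"
  obtains B where "\<And>k l z. k < n \<Longrightarrow> l < n \<Longrightarrow>
    cmod (z - disc_centre x y k l) \<le> disc_radius x y k l \<Longrightarrow> cmod z \<le> B"
proof
  fix k l z assume k: "k < n" and l: "l < n" and z: "cmod (z - disc_centre x y k l) \<le> disc_radius x y k l"
  define f where "f k l = cmod (disc_centre x y k l) + disc_radius x y k l" for k l
  have f: "f k l \<ge> 0" if "k < n" "l < n" for k l
    using disc_radius_nonneg[OF int_cone_plusD(3)[OF x that], of y] by (simp add: f_def)
  have "cmod z \<le> f k l"
    using z norm_triangle_sub[of z "disc_centre x y k l"] by (simp add: f_def)
  also have "\<dots> \<le> (\<Sum>l<n. f k l)" using l k f by (intro member_le_sum) auto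
  also have "\<dots> \<le> (\<Sum>k<n. \<Sum>l<n. f k l)"
    using k f by (intro member_le_sum[of k _ "\<lambda>k. \<Sum>l<n. f k l"] sum_nonneg) auto
  finally show "cmod z \<le> (\<Sum>k<n. \<Sum>l<n. cmod (disc_centre x y k l) + disc_radius x y k l)"
    by (simp add: f_def)
qed

lemma closed_E_bounded:
  assumes x: "x \<in> int_cone_plus n" and y: "y \<in> carrier_vec n"
  obtains d where "\<And>p q. p \<in> closed_E n x y \<Longrightarrow> q \<in> closed_E n x y \<Longrightarrow> cmod (p - q) \<le> d"
proof -
  obtain B where B: "\<And>k l z. k < n \<Longrightarrow> l < n \<Longrightarrow>
    cmod (z - disc_centre x y k l) \<le> disc_radius x y k l \<Longrightarrow> cmod z \<le> B" using discs_bounded[OF x, of y] by blast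
  have "cmod z \<le> B" if "z \<in> closed_E n x y" for z
    using that unfolding mem_closed_E_iff[OF x y]
    using B mem_disc_iff[OF int_cone_plusD(3)[OF x]] by blast
  then show thesis using that[of "B + B"] by (meson add_mono norm_triangle_ineq4 order_trans)
qed

text \<open>A point of a closed disc of positive radius is a limit of points of the open disc. A disc of radius
  \<open>0\<close> consists of a coordinate ratio \<open>y\<^sub>k / x\<^sub>k\<close>; since \<open>x\<close> and \<open>y\<close> are not colinear, some other
  ratio \<open>y\<^sub>m / x\<^sub>m\<close> differs from it, and it also lies in the disc of \<open>m\<close> and \<open>k\<close>.\<close>

lemma E_set_dense_in_closed_E:
  assumes x: "x \<in> int_cone_plus n" and y: "y \<in> carrier_vec n" and n: "0 < n"
    and ncol: "\<not> colinear x y" and z: "z \<in> closed_E n x y" and \<epsilon>: "\<epsilon> > 0"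
  obtains z' where "z' \<in> E_set (cone_plus n) x y" "cmod (z' - z) < \<epsilon>"
proof -
  have "\<exists>k<n. \<exists>l<n. cmod (z - disc_centre x y k l) \<le> disc_radius x y k l \<and> disc_radius x y k l > 0"
  proof -
    obtain k l where k: "k < n" and l: "l < n"
      and d: "cmod (z - disc_centre x y k l) \<le> disc_radius x y k l"
      using z unfolding mem_closed_E_iff[OF x y]
      using mem_disc_iff[OF int_cone_plusD(3)[OF x]] by blast
    show ?thesis
    proof (cases "disc_radius x y k l > 0")
      case True with k l d show ?thesis by blast
    next
      case False
      with d have r0: "disc_radius x y k l = 0" and zc: "z = disc_centre x y k l"
        using norm_ge_zero[of "z - disc_centre x y k l"]
        by (linarith, metis diff_eq_diff_eq diff_self dual_order.trans norm_le_zero_iff not_less)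
      have zk: "z = y $ k / x $ k"
        using coordinate_ratio_mem_disc(1)[OF x k l, of y] r0 zc by simp
      obtain m where m: "m < n" "y $ m / x $ m \<noteq> y $ k / x $ k"
        using distinct_ratios[OF x y n ncol k] .
      have "disc_radius x y m k > 0" by (rule disc_radius_pos[OF x m(1) k m(2)])
      moreover have "cmod (z - disc_centre x y m k) \<le> disc_radius x y m k"
        unfolding zk by (rule coordinate_ratio_mem_disc(2)[OF x m(1) k])
      ultimately show ?thesis using m k by blast
    qed
  qed
  then obtain k l where k: "k < n" and l: "l < n"
    and d: "cmod (z - disc_centre x y k l) \<le> disc_radius x y k l" and r: "disc_radius x y k l > 0" by blast
  define c where "c = disc_centre x y k l"
  define \<rho> where "\<rho> = disc_radius x y k l"
  \<comment> \<open>Move \<open>z\<close> a little towards the centre.\<close>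
  define t where "t = min 1 (\<epsilon> / (2 * \<rho>))"
  have t: "0 < t" "t \<le> 1" "t * \<rho> < \<epsilon>" using \<epsilon> r
    by (auto simp: t_def \<rho>_def min_def field_simps)
  define z' where "z' = z + of_real t * (c - z)"
  have "z' - c = of_real (1 - t) * (z - c)" by (simp add: z'_def algebra_simps)
  then have "cmod (z' - c) = (1 - t) * cmod (z - c)"
    using t by (simp only: norm_mult norm_of_real abs_of_nonneg diff_ge_0_iff_ge)
  also have "\<dots> \<le> (1 - t) * \<rho>" using d t by (intro mult_left_mono) (auto simp: c_def \<rho>_def)
  also have "\<dots> < \<rho>" using t r by (simp add: \<rho>_def)
  finally have "z' \<in> E_set (cone_plus n) x y"
    unfolding mem_E_set_iff[OF x y] c_def \<rho>_def
    using mem_open_disc_iff[OF int_cone_plusD(3)[OF x k l]] k l by blast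
  moreover have "cmod (z' - z) < \<epsilon>"
  proof -
    have "cmod (z' - z) = t * cmod (z - c)" using t by (simp add: z'_def norm_mult norm_minus_commute)
    also have "\<dots> \<le> t * \<rho>" using d t by (intro mult_left_mono) (auto simp: c_def \<rho>_def)
    finally show ?thesis using t by simp
  qed
  ultimately show thesis by (rule that)
qed

lemma cone_plus_smult_iff:
  assumes v: "v \<in> carrier_vec n" and \<kappa>: "\<kappa> \<noteq> 0"
  shows "\<kappa> \<cdot>\<^sub>v v \<in> cone_plus n \<longleftrightarrow> v \<in> cone_plus n"
    and "\<kappa> \<cdot>\<^sub>v v \<in> int_cone_plus n \<longleftrightarrow> v \<in> int_cone_plus n"
proof -
  have "Re ((\<kappa> \<cdot>\<^sub>v v) $ k * cnj ((\<kappa> \<cdot>\<^sub>v v) $ l)) = (cmod \<kappa>)\<^sup>2 * Re (v $ k * cnj (v $ l))"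
    if "k < n" "l < n" for k l
  proof -
    have "(\<kappa> \<cdot>\<^sub>v v) $ k * cnj ((\<kappa> \<cdot>\<^sub>v v) $ l) = of_real ((cmod \<kappa>)\<^sup>2) * (v $ k * cnj (v $ l))"
      unfolding complex_norm_square using v that by (simp add: mult_ac)
    then show ?thesis by (simp only: Re_complex_of_real times_complex.sel Im_complex_of_real)
  qed
  note scale = this
  have k2: "(cmod \<kappa>)\<^sup>2 > 0" using \<kappa> by simp
  show "\<kappa> \<cdot>\<^sub>v v \<in> cone_plus n \<longleftrightarrow> v \<in> cone_plus n"
    unfolding cone_plus_def mem_Collect_eq using v scale k2
    by (auto simp: zero_le_mult_iff simp del: index_smult_vec times_complex.sel)
  show "\<kappa> \<cdot>\<^sub>v v \<in> int_cone_plus n \<longleftrightarrow> v \<in> int_cone_plus n"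
    unfolding int_cone_plus_def mem_Collect_eq using v scale k2
    by (auto simp: zero_less_mult_iff simp del: index_smult_vec times_complex.sel)
qed

lemma mult_mat_vec_lin_comb:
  fixes A :: "complex mat"
  assumes "A \<in> carrier_mat n n" "x \<in> carrier_vec n" "y \<in> carrier_vec n"
  shows "A *\<^sub>v (z \<cdot>\<^sub>v x - y) = z \<cdot>\<^sub>v (A *\<^sub>v x) - A *\<^sub>v y"
  using assms by (simp add: mult_minus_distrib_mat_vec mult_mat_vec)

lemma closed_E_image_subset:
  assumes n: "0 < n" and A: "A \<in> carrier_mat n n"
    and M: "(\<lambda>x. A *\<^sub>v x) ` (cone_plus n - {0\<^sub>v n}) \<subseteq> int_cone_plus n"
    and x: "x \<in> carrier_vec n" and y: "y \<in> carrier_vec n"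
  shows "closed_E n (A *\<^sub>v x) (A *\<^sub>v y) \<subseteq> closed_E n x y"
proof
  fix z assume z: "z \<in> closed_E n (A *\<^sub>v x) (A *\<^sub>v y)"
  show "z \<in> closed_E n x y"
  proof (rule ccontr)
    assume "z \<notin> closed_E n x y"
    then have "z \<cdot>\<^sub>v x - y \<in> int_cone_plus n" by (simp add: closed_E_def)
    then have "A *\<^sub>v (z \<cdot>\<^sub>v x - y) \<in> int_cone_plus n"
      using M int_cone_plusD(5,6) n by blast
    with z show False unfolding mult_mat_vec_lin_comb[OF A x y] closed_E_def by blast
  qed
qed

text \<open>The hypothesis bounds the cross-ratio of four collinear points with consecutive distances \<open>s\<close>, \<open>m\<close>,
  \<open>t\<close>. With the outer points fixed and \<open>m\<close> given, the cross-ratio is least for \<open>s = t\<close>, by the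
  inequality of arithmetic and geometric means, and then equals \<open>((L + m) / (L - m))\<^sup>2\<close> for \<open>L = s + t + m\<close>.\<close>

lemma cross_ratio_tanh:
  fixes s t m D :: real
  assumes pos: "0 < s" "0 < t" "0 < m" and le: "(m + s) * (m + t) \<le> exp D * (t * s)"
  shows "m \<le> tanh (D / 4) * (s + t + m)"
proof -
  define G where "G = exp (D / 2)"
  have G2: "exp D = G\<^sup>2" by (simp add: G_def power2_eq_square flip: exp_add)
  have G0: "G > 0" by (simp add: G_def)
  have amgm: "4 * (t * s) \<le> (s + t)\<^sup>2"
    using zero_le_power2[of "s - t"] by (simp add: power2_eq_square algebra_simps)
  have st: "t * s > 0" using pos by simp
  have "m * (s + t + m) \<le> (G\<^sup>2 - 1) * (t * s)" using le unfolding G2 by (simp add: algebra_simps)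
  moreover have "m * (s + t + m) > 0" using pos by simp
  ultimately have "(G\<^sup>2 - 1) * (t * s) > 0" by linarith
  then have G1: "G\<^sup>2 - 1 > 0" using st by (simp add: zero_less_mult_iff)
  have "4 * (m * (s + t + m)) \<le> (G\<^sup>2 - 1) * (4 * (t * s))"
    using \<open>m * (s + t + m) \<le> (G\<^sup>2 - 1) * (t * s)\<close> by simp
  also have "\<dots> \<le> (G\<^sup>2 - 1) * (s + t)\<^sup>2" using G1 amgm by (intro mult_left_mono) auto
  finally have "(s + t + 2 * m)\<^sup>2 \<le> (G * (s + t))\<^sup>2"
    by (simp add: power2_eq_square algebra_simps)
  then have "s + t + 2 * m \<le> G * (s + t)"
    by (rule power2_le_imp_le) (use G0 pos in auto)
  then have "m * (G + 1) \<le> (G - 1) * (s + t + m)" by (simp add: algebra_simps)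
  then have "m \<le> (G - 1) / (G + 1) * (s + t + m)" using G0 by (simp add: field_simps)
  moreover have "tanh (D / 4) = (G - 1) / (G + 1)"
  proof -
    have "exp (- 2 * (D / 4)) = 1 / G" by (simp add: G_def exp_minus inverse_eq_divide)
    then show ?thesis using G0 by (simp only: tanh_real_altdef) (simp add: divide_simps)
  qed
  ultimately show ?thesis by simp
qed

text \<open>The geometric core. Bound \<open>closed_E n x y\<close> by a strip with edges perpendicular to \<open>p - q\<close>, of width at most
  \<open>d\<close>, and let \<open>z1\<close>, \<open>z2\<close> be the points where the line through \<open>p\<close> and \<open>q\<close> leaves a slightly wider
  strip. Then \<open>z1 x - y\<close> and \<open>z2 x - y\<close> lie in the cone, and the map \<open>w \<mapsto> (w - z2) / (w - z1)\<close>
  carries the set \<open>E\<close> of \<open>A x\<close>, \<open>A y\<close> into that of the images of these two vectors. The images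
  have projective distance at most \<open>D\<close>, which bounds the cross-ratio of \<open>z1, p, q, z2\<close> by \<open>exp D\<close>.\<close>

lemma E_set_contraction:
  assumes n: "0 < n" and A: "A \<in> carrier_mat n n"
    and M: "(\<lambda>x. A *\<^sub>v x) ` (cone_plus n - {0\<^sub>v n}) \<subseteq> int_cone_plus n"
    and D: "image_diameter n A \<le> ereal D" "D \<ge> 0"
    and x: "x \<in> int_cone_plus n" and y: "y \<in> carrier_vec n"
    and d: "\<And>p q. p \<in> closed_E n x y \<Longrightarrow> q \<in> closed_E n x y \<Longrightarrow> cmod (p - q) \<le> d"
    and ncol: "\<not> colinear (A *\<^sub>v x) (A *\<^sub>v y)"
    and p: "p \<in> E_set (cone_plus n) (A *\<^sub>v x) (A *\<^sub>v y)"
    and q: "q \<in> E_set (cone_plus n) (A *\<^sub>v x) (A *\<^sub>v y)"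
  shows "cmod (p - q) \<le> tanh (D / 4) * d"
proof (cases "p = q")
  case True
  have "y $ 0 / x $ 0 \<in> closed_E n x y" by (rule ratio_mem_closed_E[OF x y n])
  from d[OF this this] have "d \<ge> 0" by simp
  then show ?thesis using True D by simp
next
  case False
  have xc: "x \<in> carrier_vec n" by (rule int_cone_plusD(1)[OF x])
  define X where "X = A *\<^sub>v x"
  define Y where "Y = A *\<^sub>v y"
  have Xc: "X \<in> carrier_vec n" and Yc: "Y \<in> carrier_vec n" using A xc y by (auto simp: X_def Y_def)
  have E_sub: "E_set (cone_plus n) X Y \<subseteq> closed_E n x y"
    using closed_E_image_subset[OF n A M xc y] int_cone_plusD(5)
    unfolding X_def Y_def E_set_def closed_E_def by blast
  have pK: "p \<in> closed_E n x y" and qK: "q \<in> closed_E n x y"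
    using E_sub p q by (auto simp: X_def Y_def)
  define m where "m = cmod (p - q)"
  have m: "m > 0" using False by (simp add: m_def)
  define u where "u = (p - q) / of_real m"
  have u1: "cmod u = 1" using m by (simp add: u_def norm_divide m_def)
  have pq: "p = q + of_real m * u" using m by (simp add: u_def)
  define g where "g z = Re (z * cnj u)" for z
  have uu: "u * cnj u = 1" using u1 by (simp add: complex_norm_square[symmetric])
  have g_line: "g (w + of_real t * u) = g w + t" for w t
  proof -
    have "(w + of_real t * u) * cnj u = w * cnj u + of_real t"
      by (simp only: distrib_right mult.assoc uu mult_1_right)
    then show ?thesis by (simp add: g_def)
  qed
  have g_diff: "g z - g w \<le> d" if "z \<in> closed_E n x y" "w \<in> closed_E n x y" for z w
  proof -
    have "g z - g w = Re ((z - w) * cnj u)" by (simp add: g_def algebra_simps)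
    also have "\<dots> \<le> cmod ((z - w) * cnj u)" by (rule complex_Re_le_cmod)
    also have "\<dots> \<le> d" using d[OF that] u1 by (simp add: norm_mult)
    finally show ?thesis .
  qed
  \<comment> \<open>The strip is \<open>lo \<le> g z \<le> lo + d\<close>.\<close>
  define lo where "lo = Inf (g ` closed_E n x y)"
  have bdd: "bdd_below (g ` closed_E n x y)"
    using g_diff[OF pK] by (intro bdd_belowI[of _ "g p - d"]) (auto simp: algebra_simps)
  have lo: "lo \<le> g z" if "z \<in> closed_E n x y" for z
    unfolding lo_def using bdd that by (intro cInf_lower) auto
  have hi: "g z \<le> lo + d" if z: "z \<in> closed_E n x y" for z
  proof -
    have "g z - d \<le> lo" unfolding lo_def using g_diff[OF z] pK
      by (intro cInf_greatest) (auto simp: algebra_simps)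
    then show ?thesis by simp
  qed
  have step: "m \<le> tanh (D / 4) * (d + 2 * \<epsilon>)" if \<epsilon>: "\<epsilon> > 0" for \<epsilon>
  proof -
    define s where "s = g q - lo + \<epsilon>"
    define t where "t = lo + d + \<epsilon> - g p"
    have s: "s > 0" using lo[OF qK] \<epsilon> by (simp add: s_def)
    have t: "t > 0" using hi[OF pK] \<epsilon> by (simp add: t_def)
    have gp: "g p = g q + m" unfolding pq by (rule g_line)
    have len: "s + t + m = d + 2 * \<epsilon>" by (simp add: s_def t_def gp)
    define z1 where "z1 = q + of_real (m + t) * u"
    define z2 where "z2 = q + of_real (- s) * u"
    have z1: "z1 \<notin> closed_E n x y"
      using hi[of z1] \<epsilon> unfolding z1_def g_line by (auto simp: t_def gp)
    have z2: "z2 \<notin> closed_E n x y"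
      using lo[of z2] \<epsilon> unfolding z2_def g_line by (auto simp: s_def)
    have z12: "z1 - z2 = of_real (s + t + m) * u" by (simp add: z1_def z2_def algebra_simps)
    have u0: "u \<noteq> 0" using u1 by auto
    have z12ne: "z1 - z2 \<noteq> 0" unfolding z12 using s t m u0 by (simp del: of_real_add)
    define X1 where "X1 = z1 \<cdot>\<^sub>v X - Y"
    define X2 where "X2 = z2 \<cdot>\<^sub>v X - Y"
    have X12: "X1 = A *\<^sub>v (z1 \<cdot>\<^sub>v x - y)" "X2 = A *\<^sub>v (z2 \<cdot>\<^sub>v x - y)"
      by (simp_all add: X1_def X2_def X_def Y_def mult_mat_vec_lin_comb[OF A xc y])
    have ncol12: "\<not> colinear X1 X2"
    proof
      assume "colinear X1 X2"
      then obtain \<alpha> \<beta> where ab: "\<alpha> \<noteq> 0 \<or> \<beta> \<noteq> 0" "\<alpha> \<cdot>\<^sub>v X1 + \<beta> \<cdot>\<^sub>v X2 = 0\<^sub>v n"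
        using Xc Yc unfolding colinear_def X1_def by auto
      have "(\<alpha> * z1 + \<beta> * z2) \<cdot>\<^sub>v X + (- (\<alpha> + \<beta>)) \<cdot>\<^sub>v Y = \<alpha> \<cdot>\<^sub>v X1 + \<beta> \<cdot>\<^sub>v X2"
        using Xc Yc by (intro eq_vecI) (auto simp: X1_def X2_def algebra_simps)
      also have "\<dots> = 0\<^sub>v (dim_vec X)" using ab Xc by simp
      finally have "\<alpha> * z1 + \<beta> * z2 = 0 \<and> - (\<alpha> + \<beta>) = 0"
        using ncol unfolding colinear_def X_def[symmetric] Y_def[symmetric] by blast
      then have "\<beta> = - \<alpha>" "\<alpha> * (z1 - z2) = 0"
        by (auto simp: algebra_simps add_eq_0_iff)
      with ab z12ne show False by auto
    qed
    have le: "proj_metric (cone_plus n) X1 X2 \<le> ereal D"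
    proof -
      have in1: "z1 \<cdot>\<^sub>v x - y \<in> cone_plus n - {0\<^sub>v n}" and in2: "z2 \<cdot>\<^sub>v x - y \<in> cone_plus n - {0\<^sub>v n}"
        using z1 z2 int_cone_plusD(5,6) n unfolding closed_E_def by auto
      have "proj_metric (cone_plus n) X1 X2 \<le> image_diameter n A"
        unfolding image_diameter_def X12 by (rule SUP_upper2[OF in1 SUP_upper[OF in2]])
      then show ?thesis using D(1) by (rule order_trans)
    qed
    have transfer: "(w - z2) / (w - z1) \<in> E_set (cone_plus n) X1 X2"
      if w: "w \<in> E_set (cone_plus n) X Y" for w
    proof -
      have wz1: "w - z1 \<noteq> 0" using w E_sub z1 by auto
      define \<zeta> where "\<zeta> = (w - z2) / (w - z1)"
      have \<zeta>1: "\<zeta> - 1 = (z1 - z2) / (w - z1)" using wz1 by (simp add: \<zeta>_def field_simps)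
      have "\<zeta> * (w - z1) = w - z2" using wz1 by (simp add: \<zeta>_def)
      then have \<zeta>z: "\<zeta> * z1 - z2 = (\<zeta> - 1) * w" by (simp add: algebra_simps)
      have "\<zeta> \<cdot>\<^sub>v X1 - X2 = (\<zeta> - 1) \<cdot>\<^sub>v (w \<cdot>\<^sub>v X - Y)"
      proof (rule eq_vecI)
        fix i assume "i < dim_vec ((\<zeta> - 1) \<cdot>\<^sub>v (w \<cdot>\<^sub>v X - Y))"
        then have i: "i < n" using Yc by simp
        have "(\<zeta> \<cdot>\<^sub>v X1 - X2) $ i = (\<zeta> * z1 - z2) * X $ i - (\<zeta> - 1) * Y $ i"
          using i Xc Yc by (simp add: X1_def X2_def algebra_simps)
        also have "\<dots> = ((\<zeta> - 1) \<cdot>\<^sub>v (w \<cdot>\<^sub>v X - Y)) $ i"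
          unfolding \<zeta>z using i Xc Yc by (simp add: algebra_simps)
        finally show "(\<zeta> \<cdot>\<^sub>v X1 - X2) $ i = ((\<zeta> - 1) \<cdot>\<^sub>v (w \<cdot>\<^sub>v X - Y)) $ i" .
      qed (use Xc Yc in \<open>auto simp: X1_def X2_def\<close>)
      moreover have "\<zeta> - 1 \<noteq> 0" unfolding \<zeta>1 using z12ne wz1 by simp
      moreover have "w \<cdot>\<^sub>v X - Y \<in> carrier_vec n" using Xc Yc by simp
      ultimately show ?thesis
        using w cone_plus_smult_iff(1) unfolding E_set_def \<zeta>_def[symmetric] by auto
    qed
    have "cmod ((p - z2) / (p - z1)) \<le> exp D * cmod ((q - z2) / (q - z1))"
      using p q by (intro proj_metric_leD[OF le ncol12] transfer) (auto simp: X_def Y_def)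
    moreover have "cmod (p - z2) = m + s" "cmod (p - z1) = t" "cmod (q - z2) = s" "cmod (q - z1) = m + t"
    proof -
      have "p - z2 = of_real (m + s) * u" "p - z1 = of_real (- t) * u"
        "q - z2 = of_real s * u" "q - z1 = of_real (- (m + t)) * u"
        by (simp_all add: pq z1_def z2_def algebra_simps)
      then show "cmod (p - z2) = m + s" "cmod (p - z1) = t" "cmod (q - z2) = s" "cmod (q - z1) = m + t"
        using u1 s t m by (simp_all only: norm_mult norm_of_real) auto
    qed
    ultimately have "(m + s) / t \<le> exp D * (s / (m + t))" by (simp add: norm_divide)
    then have "(m + s) * (m + t) \<le> exp D * (t * s)"
      using s t m by (simp add: field_simps)
    from cross_ratio_tanh[OF s t m this] show ?thesis unfolding len .
  qed
  have "m \<le> tanh (D / 4) * d + e" if e: "e > 0" for e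
  proof -
    have "m \<le> tanh (D / 4) * (d + 2 * (e / 2))" using e by (intro step) simp
    also have "\<dots> \<le> tanh (D / 4) * d + e"
      using mult_right_mono[of "tanh (D / 4)" 1 e] tanh_real_lt_1[of "D / 4"] e by (simp add: algebra_simps)
    finally show ?thesis .
  qed
  then show ?thesis unfolding m_def by (rule field_le_epsilon)
qed

lemma closed_E_contraction:
  assumes n: "0 < n" and A: "A \<in> carrier_mat n n"
    and M: "(\<lambda>x. A *\<^sub>v x) ` (cone_plus n - {0\<^sub>v n}) \<subseteq> int_cone_plus n"
    and D: "image_diameter n A \<le> ereal D" "D \<ge> 0"
    and x: "x \<in> int_cone_plus n" and y: "y \<in> carrier_vec n"
    and d: "\<And>p q. p \<in> closed_E n x y \<Longrightarrow> q \<in> closed_E n x y \<Longrightarrow> cmod (p - q) \<le> d"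
    and p: "p \<in> closed_E n (A *\<^sub>v x) (A *\<^sub>v y)"
    and q: "q \<in> closed_E n (A *\<^sub>v x) (A *\<^sub>v y)"
  shows "cmod (p - q) \<le> tanh (D / 4) * d"
proof -
  have X: "A *\<^sub>v x \<in> int_cone_plus n" using M int_cone_plusD(5,6)[OF x] n by blast
  have Y: "A *\<^sub>v y \<in> carrier_vec n" using A y by simp
  show ?thesis
  proof (cases "colinear (A *\<^sub>v x) (A *\<^sub>v y)")
    case True
    then obtain \<gamma> where \<gamma>: "A *\<^sub>v y = \<gamma> \<cdot>\<^sub>v (A *\<^sub>v x)" using colinear_iff_multiple[OF X Y n] by blast
    have "z = \<gamma>" if z: "z \<in> closed_E n (A *\<^sub>v x) (A *\<^sub>v y)" for z
    proof (rule ccontr)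
      assume "z \<noteq> \<gamma>"
      have "z \<cdot>\<^sub>v (A *\<^sub>v x) - A *\<^sub>v y = (z - \<gamma>) \<cdot>\<^sub>v (A *\<^sub>v x)"
        unfolding \<gamma> by (intro eq_vecI) (auto simp: algebra_simps)
      also have "\<dots> \<in> int_cone_plus n"
        using cone_plus_smult_iff(2)[OF int_cone_plusD(1)[OF X], of "z - \<gamma>"] X \<open>z \<noteq> \<gamma>\<close> by simp
      finally show False using z by (simp add: closed_E_def)
    qed
    then have "p = q" using p q by blast
    have "y $ 0 / x $ 0 \<in> closed_E n x y" by (rule ratio_mem_closed_E[OF x y n])
    from d[OF this this] have "d \<ge> 0" by simp
    then show ?thesis using \<open>p = q\<close> D by simp
  next
    case ncol: False
    have "cmod (p - q) \<le> tanh (D / 4) * d + e" if e: "e > 0" for e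
    proof -
      obtain p' where p': "p' \<in> E_set (cone_plus n) (A *\<^sub>v x) (A *\<^sub>v y)" "cmod (p' - p) < e / 2"
        using E_set_dense_in_closed_E[OF X Y n ncol p, of "e / 2"] e by auto
      obtain q' where q': "q' \<in> E_set (cone_plus n) (A *\<^sub>v x) (A *\<^sub>v y)" "cmod (q' - q) < e / 2"
        using E_set_dense_in_closed_E[OF X Y n ncol q, of "e / 2"] e by auto
      have "p - q = (p' - q') - (p' - p) + (q' - q)" by simp
      then have "cmod (p - q) \<le> cmod (p' - q') + cmod (p' - p) + cmod (q' - q)"
        by (metis norm_triangle_ineq norm_triangle_ineq4 add_right_mono order_trans)
      then show ?thesis
        using E_set_contraction[OF n A M D x y d ncol p'(1) q'(1)] p' q' by linarith
    qed
    then show ?thesis by (rule field_le_epsilon)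
  qed
qed

section \<open>The dominant eigenvector\<close>

lemma bounded_complex_sequences_subsequence:
  fixes f :: "nat \<Rightarrow> nat \<Rightarrow> complex"
  assumes "\<And>j. j < n \<Longrightarrow> Bseq (\<lambda>i. f i j)"
  shows "\<exists>r. strict_mono r \<and> (\<forall>j<n. convergent (\<lambda>i. f (r i) j))"
  using assms
proof (induction n)
  case 0
  show ?case by (rule exI[of _ id]) (simp add: strict_mono_def)
next
  case (Suc n)
  then obtain r where r: "strict_mono r" "\<And>j. j < n \<Longrightarrow> convergent (\<lambda>i. f (r i) j)" by force
  have sub: "convergent (\<lambda>i. X (s i))" if "convergent X" "strict_mono s" for X :: "nat \<Rightarrow> complex" and s
    using convergent_subseq_convergent[OF that] by (simp add: o_def)
  obtain B where B: "\<And>i. cmod (f i n) \<le> B" using Suc.prems[of n] by (auto simp: Bseq_def)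
  have conv: "convergent X" if "monoseq X" "\<And>i. \<bar>X i\<bar> \<le> B" for X :: "nat \<Rightarrow> real"
    using that by (intro Bseq_monoseq_convergent BseqI'[of _ B]) auto
  obtain s where s: "strict_mono s" "monoseq (\<lambda>i. Re (f (r (s i)) n))"
    using seq_monosub[of "\<lambda>i. Re (f (r i) n)"] by blast
  obtain t where t: "strict_mono t" "monoseq (\<lambda>i. Im (f (r (s (t i))) n))"
    using seq_monosub[of "\<lambda>i. Im (f (r (s i)) n)"] by blast
  have "convergent (\<lambda>i. Re (f (r (s i)) n))"
    using s(2) B abs_Re_le_cmod order_trans by (intro conv) blast+
  then have "convergent ((\<lambda>i. Re (f (r (s i)) n)) \<circ> t)" using t(1) by (rule convergent_subseq_convergent)
  then have "convergent (\<lambda>i. Re (f (r (s (t i))) n))" by (simp add: o_def)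
  moreover have "convergent (\<lambda>i. Im (f (r (s (t i))) n))"
    using t(2) B abs_Im_le_cmod order_trans by (intro conv) blast+
  ultimately have "convergent (\<lambda>i. f (r (s (t i))) n)"
    unfolding convergent_def by (metis tendsto_complex_iff complex.sel)
  moreover have "convergent (\<lambda>i. f (r (s (t i))) j)" if "j < n" for j
    using sub[OF r(2)[OF that] strict_mono_compose[OF s(1) t(1)]] .
  moreover have "strict_mono (\<lambda>i. r (s (t i)))"
    using r(1) s(1) t(1) by (simp add: strict_mono_def)
  ultimately show ?case by (intro exI[of _ "\<lambda>i. r (s (t i))"]) (auto simp: less_Suc_eq)
qed

text \<open>For the orbit \<open>x i\<close> of the vector of ones, the sets \<open>K i\<close> of consecutive orbit points are nested and their
  diameters decay geometrically. They contain all coordinate ratios \<open>x (i + 1)\<^sub>j / x i\<^sub>j\<close>, which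
  therefore converge to one number \<open>ev\<close> for all \<open>j\<close>. The orbit normalised by its coordinate \<open>0\<close> is
  bounded, because row ratios are; any limit of a subsequence is an eigenvector for \<open>ev\<close> in the cone, and
  being an image up to scaling it lies in the interior.\<close>

lemma dominant_eigenvector:
  assumes n: "0 < n" and A: "A \<in> carrier_mat n n"
    and M: "(\<lambda>x. A *\<^sub>v x) ` (cone_plus n - {0\<^sub>v n}) \<subseteq> int_cone_plus n"
    and D: "image_diameter n A \<le> ereal D" "D \<ge> 0"
  obtains h ev where "h \<in> int_cone_plus n" "A *\<^sub>v h = ev \<cdot>\<^sub>v h" "ev \<noteq> 0"
proof -
  define \<kappa> where "\<kappa> = tanh (D / 4)"
  have \<kappa>: "0 \<le> \<kappa>" "\<kappa> < 1" using D by (auto simp: \<kappa>_def tanh_real_lt_1)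
  define x where "x i = ((\<lambda>v. A *\<^sub>v v) ^^ i) (vec n (\<lambda>_. 1))" for i
  have xS: "x (Suc i) = A *\<^sub>v x i" for i by (simp add: x_def)
  have x: "x i \<in> int_cone_plus n" for i
  proof (induction i)
    case 0 show ?case by (simp add: x_def int_cone_plus_def)
  next
    case (Suc i) then show ?case unfolding xS using M int_cone_plusD(5,6) n by blast
  qed
  have xc: "x i \<in> carrier_vec n" for i by (rule int_cone_plusD(1)[OF x])
  have x0: "x i $ k \<noteq> 0" if "k < n" for i k by (rule int_cone_plusD(4)[OF x that])
  define K where "K i = closed_E n (x i) (x (Suc i))" for i
  define \<rho> where "\<rho> i j = x (Suc i) $ j / x i $ j" for i j
  have \<rho>K: "\<rho> i j \<in> K i" if "j < n" for i j
    unfolding \<rho>_def K_def by (rule ratio_mem_closed_E[OF x xc that])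
  have "K (Suc i) \<subseteq> K i" for i
    using closed_E_image_subset[OF n A M xc xc, of i "Suc i"] by (simp only: K_def xS[symmetric])
  then have nested: "K i' \<subseteq> K i" if "i \<le> i'" for i i' using that by (rule lift_Suc_antimono_le)
  obtain d where d: "\<And>p q. p \<in> K 0 \<Longrightarrow> q \<in> K 0 \<Longrightarrow> cmod (p - q) \<le> d"
    unfolding K_def using closed_E_bounded[OF x xc] by blast
  have diam: "p \<in> K i \<Longrightarrow> q \<in> K i \<Longrightarrow> cmod (p - q) \<le> \<kappa> ^ i * d" for i p q
  proof (induction i arbitrary: p q)
    case 0 then show ?case using d by simp
  next
    case (Suc i)
    have "cmod (p - q) \<le> \<kappa> * (\<kappa> ^ i * d)" unfolding \<kappa>_def
    proof (rule closed_E_contraction[OF n A M D x xc])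
      show "cmod (p - q) \<le> tanh (D / 4) ^ i * d"
        if "p \<in> closed_E n (x i) (x (Suc i))" "q \<in> closed_E n (x i) (x (Suc i))" for p q
        using Suc.IH that unfolding K_def \<kappa>_def by blast
    qed (use Suc.prems in \<open>simp_all add: K_def xS[of i] xS[of "Suc i"]\<close>)
    then show ?case by simp
  qed
  have geo: "(\<lambda>i. \<kappa> ^ i * d) \<longlonglongrightarrow> 0"
    using \<kappa> by (intro tendsto_mult_left_zero LIMSEQ_power_zero) simp
  have "Cauchy (\<lambda>i. \<rho> i 0)"
  proof (rule metric_CauchyI)
    fix e :: real assume "e > 0"
    then obtain N where N: "\<kappa> ^ N * d < e"
      using order_tendstoD(2)[OF geo] unfolding eventually_sequentially by blast
    show "\<exists>N. \<forall>i\<ge>N. \<forall>i'\<ge>N. dist (\<rho> i 0) (\<rho> i' 0) < e"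
    proof (intro exI[of _ N] allI impI)
      fix i i' assume "i \<ge> N" "i' \<ge> N"
      then have "\<rho> i 0 \<in> K N" "\<rho> i' 0 \<in> K N" using \<rho>K[OF n] nested by blast+
      then show "dist (\<rho> i 0) (\<rho> i' 0) < e" unfolding dist_norm using diam N by (meson le_less_trans)
    qed
  qed
  then obtain ev where ev0: "(\<lambda>i. \<rho> i 0) \<longlonglongrightarrow> ev"
    using Cauchy_convergent convergent_def by blast
  have ev: "(\<lambda>i. \<rho> i j) \<longlonglongrightarrow> ev" if j: "j < n" for j
  proof -
    have "(\<lambda>i. \<rho> i j - \<rho> i 0) \<longlonglongrightarrow> 0"
      using diam[OF \<rho>K[OF j] \<rho>K[OF n]]
      by (intro tendsto_norm_zero_cancel[OF tendsto_sandwich[OF _ _ tendsto_const geo]]) simp_all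
    from tendsto_add[OF this ev0] show ?thesis by simp
  qed
  \<comment> \<open>Starting at \<open>x 1\<close>, the orbit consists of images, so that row ratios bound the quotients.\<close>
  define f where "f i j = x (Suc i) $ j / x (Suc i) $ 0" for i j
  have "Bseq (\<lambda>i. f i j)" if j: "j < n" for j
  proof -
    have row0: "row A 0 \<in> int_cone_plus n" by (rule row_mem_int_cone_plus[OF A M n])
    have rj: "row A j \<in> carrier_vec n" using A j by auto
    obtain B where B: "\<And>k l z. k < n \<Longrightarrow> l < n \<Longrightarrow>
      cmod (z - disc_centre (row A 0) (row A j) k l) \<le> disc_radius (row A 0) (row A j) k l \<Longrightarrow> cmod z \<le> B"
      using discs_bounded[OF row0] by blast
    have "cmod (f i j) \<le> B" for i
    proof -
      have fij: "f i j = (row A j \<bullet> x i) / (row A 0 \<bullet> x i)" using A j n by (simp add: f_def xS)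
      obtain p q where "p < n" "q < n"
        "cmod (f i j - disc_centre (row A 0) (row A j) p q) \<le> disc_radius (row A 0) (row A j) p q"
        unfolding fij by (rule row_ratio_mem_disc[OF row0 rj int_cone_plusD(5,6)[OF x]]) (use n in auto)
      then show ?thesis by (rule B)
    qed
    then show ?thesis by (rule BseqI')
  qed
  then obtain r where r: "strict_mono r" "\<And>j. j < n \<Longrightarrow> convergent (\<lambda>i. f (r i) j)"
    using bounded_complex_sequences_subsequence by blast
  define h where "h = vec n (\<lambda>j. lim (\<lambda>i. f (r i) j))"
  have hc: "h \<in> carrier_vec n" by (simp add: h_def)
  have h: "(\<lambda>i. f (r i) j) \<longlonglongrightarrow> h $ j" if "j < n" for j
    using r(2)[OF that] that by (simp add: h_def convergent_LIMSEQ_iff)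
  have "(\<lambda>i. f (r i) 0) = (\<lambda>_. 1)" using x0[OF n] by (simp add: f_def)
  then have "h $ 0 = 1" using h[OF n] by (simp add: LIMSEQ_const_iff)
  then have h0: "h \<noteq> 0\<^sub>v n" using n by auto
  have hC: "h \<in> cone_plus n"
  proof -
    have "0 \<le> Re (h $ k * cnj (h $ l))" if k: "k < n" and l: "l < n" for k l
    proof (rule LIMSEQ_le_const)
      show "(\<lambda>i. Re (f (r i) k * cnj (f (r i) l))) \<longlonglongrightarrow> Re (h $ k * cnj (h $ l))"
        by (intro tendsto_Re tendsto_mult tendsto_cnj h k l)
      have "0 \<le> Re (f i k * cnj (f i l))" for i
      proof -
        have "f i k * cnj (f i l) = x (Suc i) $ k * cnj (x (Suc i) $ l) / of_real ((cmod (x (Suc i) $ 0))\<^sup>2)"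
          unfolding complex_norm_square by (simp add: f_def)
        then show ?thesis
          using int_cone_plusD(3)[OF x k l, of "Suc i"]
          by (simp only: Re_divide_of_real) (simp add: less_imp_le)
      qed
      then show "\<exists>N. \<forall>i\<ge>N. 0 \<le> Re (f (r i) k * cnj (f (r i) l))" by blast
    qed
    then show ?thesis using hc by (simp add: cone_plus_def)
  qed
  have eig: "A *\<^sub>v h = ev \<cdot>\<^sub>v h"
  proof (rule eq_vecI)
    fix j assume "j < dim_vec (ev \<cdot>\<^sub>v h)"
    then have j: "j < n" using hc by simp
    have "(\<lambda>i. \<rho> (Suc (r i)) j) \<longlonglongrightarrow> ev"
      using LIMSEQ_subseq_LIMSEQ[OF LIMSEQ_Suc[OF ev[OF j]] r(1)] by (simp add: o_def)
    then have "(\<lambda>i. \<rho> (Suc (r i)) j * f (r i) j) \<longlonglongrightarrow> ev * h $ j" by (intro tendsto_mult h j)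
    moreover have "\<rho> (Suc i) j * f i j = (\<Sum>k<n. A $$ (j,k) * f i k)" for i
    proof -
      have "\<rho> (Suc i) j * f i j = (A *\<^sub>v x (Suc i)) $ j / x (Suc i) $ 0"
        using x0[OF j] by (simp add: \<rho>_def f_def xS[of "Suc i"])
      also have "\<dots> = (\<Sum>k<n. A $$ (j,k) * x (Suc i) $ k) / x (Suc i) $ 0"
        using A j xc[of "Suc i"] by (simp add: scalar_prod_def lessThan_atLeast0)
      also have "\<dots> = (\<Sum>k<n. A $$ (j,k) * f i k)" by (simp add: f_def sum_divide_distrib)
      finally show ?thesis .
    qed
    moreover have "(\<lambda>i. \<Sum>k<n. A $$ (j,k) * f (r i) k) \<longlonglongrightarrow> (\<Sum>k<n. A $$ (j,k) * h $ k)"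
      by (intro tendsto_sum tendsto_mult tendsto_const h) simp
    ultimately have "ev * h $ j = (\<Sum>k<n. A $$ (j,k) * h $ k)"
      using LIMSEQ_unique by simp
    then show "(A *\<^sub>v h) $ j = (ev \<cdot>\<^sub>v h) $ j"
      using A j hc by (simp add: scalar_prod_def lessThan_atLeast0)
  qed (use A hc in auto)
  have Ah: "A *\<^sub>v h \<in> int_cone_plus n" using M hC h0 by blast
  have ev_nz: "ev \<noteq> 0" using int_cone_plusD(4)[OF Ah n] hc n unfolding eig by auto
  then have "h \<in> int_cone_plus n" using Ah cone_plus_smult_iff(2)[OF hc] unfolding eig by blast
  then show thesis using that eig ev_nz by blast
qed

text \<open>Modulo the span of \<open>h\<close>, \<open>w\<close> is an eigenvector. As \<open>A h\<close> is a multiple of \<open>h\<close>, applying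
  \<open>A\<close> carries \<open>closed_E n h w\<close> by a similarity of ratio \<open>|\<mu>| / |ev|\<close>, yet it contracts diameters by
  \<open>tanh (D / 4)\<close>. If the ratio is the larger number, the set is a single point, so all coordinate
  ratios \<open>w\<^sub>k / h\<^sub>k\<close> agree. The term \<open>b h\<close> only translates; it is there for generalised eigenvectors.\<close>

lemma dominant_eigenvector_rigid:
  assumes n: "0 < n" and A: "A \<in> carrier_mat n n"
    and M: "(\<lambda>x. A *\<^sub>v x) ` (cone_plus n - {0\<^sub>v n}) \<subseteq> int_cone_plus n"
    and D: "image_diameter n A \<le> ereal D" "D \<ge> 0"
    and h: "h \<in> int_cone_plus n" "A *\<^sub>v h = ev \<cdot>\<^sub>v h" "ev \<noteq> 0"
    and w: "w \<in> carrier_vec n" "A *\<^sub>v w = \<mu> \<cdot>\<^sub>v w + b \<cdot>\<^sub>v h"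
    and gt: "cmod \<mu> > tanh (D / 4) * cmod ev"
  obtains \<gamma> where "w = \<gamma> \<cdot>\<^sub>v h"
proof -
  define \<kappa> where "\<kappa> = tanh (D / 4) * cmod ev / cmod \<mu>"
  have t0: "tanh (D / 4) \<ge> 0" using D by simp
  have \<mu>0: "cmod \<mu> > 0" using gt t0 by (meson le_less_trans mult_nonneg_nonneg norm_ge_zero)
  have \<kappa>: "0 \<le> \<kappa>" "\<kappa> < 1" using gt t0 \<mu>0 by (auto simp: \<kappa>_def)
  have hc: "h \<in> carrier_vec n" by (rule int_cone_plusD(1)[OF h(1)])
  let ?K = "closed_E n h w"
  have step: "\<kappa> * e \<ge> cmod (p - q)"
    if e: "\<And>p q. p \<in> ?K \<Longrightarrow> q \<in> ?K \<Longrightarrow> cmod (p - q) \<le> e" and p: "p \<in> ?K" and q: "q \<in> ?K" for e p q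
  proof -
    have tr: "(\<mu> * z + b) / ev \<in> closed_E n (A *\<^sub>v h) (A *\<^sub>v w)" if z: "z \<in> ?K" for z
    proof -
      have "((\<mu> * z + b) / ev) \<cdot>\<^sub>v (A *\<^sub>v h) - A *\<^sub>v w = \<mu> \<cdot>\<^sub>v (z \<cdot>\<^sub>v h - w)"
        unfolding h(2) w(2) using hc w(1) h(3) by (intro eq_vecI) (auto simp: field_simps)
      moreover have "z \<cdot>\<^sub>v h - w \<in> carrier_vec n" using hc w by simp
      ultimately show ?thesis
        using z cone_plus_smult_iff(2) \<mu>0 unfolding closed_E_def by auto
    qed
    have "cmod ((\<mu> * p + b) / ev - (\<mu> * q + b) / ev) \<le> tanh (D / 4) * e"
      using e by (rule closed_E_contraction[OF n A M D h(1) w(1) _ tr[OF p] tr[OF q]])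
    moreover have "(\<mu> * p + b) / ev - (\<mu> * q + b) / ev = \<mu> / ev * (p - q)"
      using h(3) by (simp add: field_simps)
    ultimately have "cmod \<mu> / cmod ev * cmod (p - q) \<le> tanh (D / 4) * e"
      by (simp add: norm_mult norm_divide)
    then show ?thesis using h(3) \<mu>0 by (simp add: \<kappa>_def field_simps)
  qed
  obtain d where d: "\<And>p q. p \<in> ?K \<Longrightarrow> q \<in> ?K \<Longrightarrow> cmod (p - q) \<le> d"
    using closed_E_bounded[OF h(1) w(1)] by blast
  have iter: "p \<in> ?K \<Longrightarrow> q \<in> ?K \<Longrightarrow> cmod (p - q) \<le> \<kappa> ^ i * d" for i p q
  proof (induction i arbitrary: p q)
    case 0 then show ?case using d by simp
  next
    case (Suc i) then show ?case using step[of "\<kappa> ^ i * d" p q] by (simp add: mult.assoc)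
  qed
  have geo: "(\<lambda>i. \<kappa> ^ i * d) \<longlonglongrightarrow> 0"
    using \<kappa> by (intro tendsto_mult_left_zero LIMSEQ_power_zero) simp
  have eq: "p = q" if "p \<in> ?K" "q \<in> ?K" for p q
    using LIMSEQ_le_const[OF geo, of "cmod (p - q)"] iter[OF that] by simp
  have "w = (w $ 0 / h $ 0) \<cdot>\<^sub>v h"
  proof (rule eq_vecI)
    fix k assume "k < dim_vec ((w $ 0 / h $ 0) \<cdot>\<^sub>v h)"
    then have k: "k < n" using hc by simp
    have "w $ k / h $ k = w $ 0 / h $ 0"
      by (intro eq ratio_mem_closed_E h(1) w(1) k n)
    then show "w $ k = ((w $ 0 / h $ 0) \<cdot>\<^sub>v h) $ k"
      using int_cone_plusD(4)[OF h(1) k] k hc by (simp add: field_simps)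
  qed (use w hc in auto)
  then show thesis by (rule that)
qed

section \<open>Spectral gap\<close>

lemma order_prod_linear:
  fixes c :: "'a :: idom"
  shows "Polynomial.order c (\<Prod>a\<leftarrow>as. [:- a, 1:]) = count_list as c"
proof (induction as)
  case Nil then show ?case by (simp add: order_1_eq_0)
next
  case (Cons a as)
  have "(\<Prod>a\<leftarrow>as. [:- a, 1:]) \<noteq> 0" by (auto simp: prod_list_zero_iff)
  then have "[:- a, 1:] * (\<Prod>a\<leftarrow>as. [:- a, 1:]) \<noteq> 0" by (simp only: mult_eq_0_iff) simp
  note order_mult[OF this]
  moreover have "Polynomial.order c [:- a, 1:] = (if a = c then 1 else 0)"
    by (auto simp: order_linear' order_0I)
  ultimately show ?case using Cons.IH by (simp only: list.map prod_list.Cons count_list.simps) simp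
qed

text \<open>The first two columns of a Schur basis in which the multiple eigenvalue comes first on the diagonal:
  they span an invariant plane on which \<open>A\<close> is upper triangular. The last conclusion is their linear
  independence in the form of not being multiples of one vector.\<close>

lemma multiple_eigenvalue_chain:
  fixes A :: "complex mat"
  assumes A: "A \<in> carrier_mat n n" and ord: "Polynomial.order ev (char_poly A) \<ge> 2"
  obtains v w b where "v \<in> carrier_vec n" "w \<in> carrier_vec n" "A *\<^sub>v v = ev \<cdot>\<^sub>v v"
    "A *\<^sub>v w = ev \<cdot>\<^sub>v w + b \<cdot>\<^sub>v v" "\<And>\<alpha> \<beta> h. h \<in> carrier_vec n \<Longrightarrow> v = \<alpha> \<cdot>\<^sub>v h \<Longrightarrow> w = \<beta> \<cdot>\<^sub>v h \<Longrightarrow> False"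
proof -
  obtain as where as: "char_poly A = (\<Prod>a\<leftarrow>as. [:- a, 1:])" using char_poly_factorized[OF A] by blast
  have cnt: "count_list as ev \<ge> 2" using ord unfolding as order_prod_linear .
  define f where "f a = [:- a, 1:]" for a :: complex
  have "ev \<in> set as" using cnt by (metis count_list_0_iff not_numeral_le_zero)
  then obtain ys zs where yz: "as = ys @ ev # zs" by (meson split_list)
  have "count_list (ys @ zs) ev \<noteq> 0" using cnt unfolding yz by (simp only: count_list_append count_list.simps simp_thms if_True)
  then have "ev \<in> set (ys @ zs)" by (simp only: count_list_0_iff) simp
  then obtain us vs where uv: "ys @ zs = us @ ev # vs" by (meson split_list)
  define es where "es = ev # ev # us @ vs"
  have "prod_list (map f as) = f ev * prod_list (map f (ys @ zs))" by (simp add: yz mult_ac)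
  also have "\<dots> = prod_list (map f es)" unfolding uv by (simp add: es_def mult_ac)
  finally have es: "char_poly A = (\<Prod>a\<leftarrow>es. [:- a, 1:])" unfolding as f_def .
  obtain B P Q where BPQ: "schur_decomposition A es = (B, P, Q)" by (cases "schur_decomposition A es")
  from schur_decomposition[OF A es this]
  have sim: "similar_mat_wit A B P Q" and ut: "upper_triangular B" and diag: "diag_mat B = es" by auto
  from similar_mat_witD2[OF A sim]
  have PQ: "P * Q = 1\<^sub>m n" "Q * P = 1\<^sub>m n" and APBQ: "A = P * B * Q"
    and B: "B \<in> carrier_mat n n" and P: "P \<in> carrier_mat n n" and Q: "Q \<in> carrier_mat n n" by auto
  have "length es = n" using B by (simp add: diag_mat_def flip: diag)
  then have n2: "2 \<le> n" by (simp add: es_def)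
  have dia: "B $$ (i,i) = es ! i" if "i < n" for i
    using B that by (simp add: diag_mat_def flip: diag)
  have B00: "B $$ (0,0) = ev" and B11: "B $$ (1,1) = ev"
    using dia[of 0] dia[of 1] n2 by (auto simp: es_def)
  define e0 :: "complex vec" where "e0 = unit_vec n 0"
  define e1 :: "complex vec" where "e1 = unit_vec n 1"
  have ec: "e0 \<in> carrier_vec n" "e1 \<in> carrier_vec n" by (auto simp: e0_def e1_def)
  have Be0: "B *\<^sub>v e0 = ev \<cdot>\<^sub>v e0"
  proof (rule eq_vecI)
    fix i assume "i < dim_vec (ev \<cdot>\<^sub>v e0)"
    then have i: "i < n" by (simp add: e0_def)
    have "(B *\<^sub>v e0) $ i = B $$ (i, 0)" using B i n2 by (simp add: e0_def)
    then show "(B *\<^sub>v e0) $ i = (ev \<cdot>\<^sub>v e0) $ i"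
      using i n2 B00 ut B by (cases "i = 0") (auto simp: e0_def upper_triangular_def)
  qed (use B in \<open>auto simp: e0_def\<close>)
  define b where "b = B $$ (0, 1)"
  have Be1: "B *\<^sub>v e1 = ev \<cdot>\<^sub>v e1 + b \<cdot>\<^sub>v e0"
  proof (rule eq_vecI)
    fix i assume "i < dim_vec (ev \<cdot>\<^sub>v e1 + b \<cdot>\<^sub>v e0)"
    then have i: "i < n" by (simp add: e0_def)
    have "(B *\<^sub>v e1) $ i = B $$ (i, 1)" using B i n2 by (simp add: e1_def)
    moreover consider "i = 0" | "i = 1" | "i > 1" by linarith
    ultimately show "(B *\<^sub>v e1) $ i = (ev \<cdot>\<^sub>v e1 + b \<cdot>\<^sub>v e0) $ i"
      using i n2 B11 ut B by cases (auto simp: e0_def e1_def b_def upper_triangular_def)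
  qed (use B in \<open>auto simp: e0_def\<close>)
  have conj: "A *\<^sub>v (P *\<^sub>v u) = P *\<^sub>v (B *\<^sub>v u)" if u: "u \<in> carrier_vec n" for u
  proof -
    have "A * P = P * B" unfolding APBQ using P Q B PQ by (simp add: assoc_mult_mat[of _ n n _ n _ n])
    then show ?thesis using A P B u by (metis assoc_mult_mat_vec)
  qed
  have QP: "Q *\<^sub>v (P *\<^sub>v u) = u" if u: "u \<in> carrier_vec n" for u
    using assoc_mult_mat_vec[OF Q P u] PQ u by simp
  show thesis
  proof (rule that[of "P *\<^sub>v e0" "P *\<^sub>v e1" b])
    show "A *\<^sub>v (P *\<^sub>v e0) = ev \<cdot>\<^sub>v (P *\<^sub>v e0)" unfolding conj[OF ec(1)] Be0 by (rule mult_mat_vec[OF P ec(1)])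
    show "A *\<^sub>v (P *\<^sub>v e1) = ev \<cdot>\<^sub>v (P *\<^sub>v e1) + b \<cdot>\<^sub>v (P *\<^sub>v e0)"
      unfolding conj[OF ec(2)] Be1 using P ec by (simp add: mult_add_distrib_mat_vec mult_mat_vec)
    fix \<alpha> \<beta> h assume h: "h \<in> carrier_vec n" "P *\<^sub>v e0 = \<alpha> \<cdot>\<^sub>v h" "P *\<^sub>v e1 = \<beta> \<cdot>\<^sub>v h"
    define g where "g = Q *\<^sub>v h"
    have gc: "g \<in> carrier_vec n" using Q h by (simp add: g_def)
    have g: "e0 = \<alpha> \<cdot>\<^sub>v g" "e1 = \<beta> \<cdot>\<^sub>v g"
      using QP[OF ec(1)] QP[OF ec(2)] mult_mat_vec[OF Q h(1)] unfolding h g_def by simp_all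
    have "\<alpha> * g $ 0 = 1" using arg_cong[OF g(1), of "\<lambda>v. v $ 0"] gc n2 by (simp add: e0_def)
    moreover have "\<beta> * g $ 0 = 0" using arg_cong[OF g(2), of "\<lambda>v. v $ 0"] gc n2 by (simp add: e1_def)
    moreover have "\<beta> * g $ 1 = 1" using arg_cong[OF g(2), of "\<lambda>v. v $ 1"] gc n2 by (simp add: e1_def)
    ultimately show False by auto
  qed (use P ec in auto)
qed

text \<open>By rigidity, an eigenvector for an eigenvalue of modulus larger than \<open>tanh (D / 4) |ev|\<close> is a
  multiple of \<open>h\<close>, so the eigenvalue is \<open>ev\<close>. If \<open>ev\<close> were a multiple root, rigidity would make both
  members of a chain for \<open>ev\<close> multiples of \<open>h\<close>.\<close>

lemma spectral_gap_of_cone_map: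
  assumes n: "0 < n" and A: "A \<in> carrier_mat n n"
    and M: "(\<lambda>x. A *\<^sub>v x) ` (cone_plus n - {0\<^sub>v n}) \<subseteq> int_cone_plus n"
    and D: "image_diameter n A \<le> ereal D" "D \<ge> 0"
  shows "spectral_gap A (tanh (D / 4))"
proof -
  define c where "c = tanh (D / 4)"
  have c: "c < 1" by (simp add: c_def tanh_real_lt_1)
  obtain h ev where h: "h \<in> int_cone_plus n" "A *\<^sub>v h = ev \<cdot>\<^sub>v h" "ev \<noteq> 0"
    using dominant_eigenvector[OF n A M D] .
  have hc: "h \<in> carrier_vec n" and h0: "h \<noteq> 0\<^sub>v n" using int_cone_plusD(1,6)[OF h(1)] n by auto
  have cev: "c * cmod ev < cmod ev" using c h(3) by simp
  have eig: "eigenvalue A ev"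
    unfolding eigenvalue_def eigenvector_def using A h(2) hc h0 by (intro exI[of _ h]) auto
  have rigid: "\<exists>\<gamma>. w = \<gamma> \<cdot>\<^sub>v h"
    if "w \<in> carrier_vec n" "A *\<^sub>v w = \<mu> \<cdot>\<^sub>v w + b \<cdot>\<^sub>v h" "cmod \<mu> > c * cmod ev" for w \<mu> b
    using dominant_eigenvector_rigid[OF n A M D h that(1,2)] that(3) unfolding c_def by blast
  have others: "cmod \<mu> \<le> c * cmod ev" if ev': "eigenvalue A \<mu>" and ne: "\<mu> \<noteq> ev" for \<mu>
  proof (rule ccontr)
    assume "\<not> ?thesis"
    then have gt: "cmod \<mu> > c * cmod ev" by simp
    obtain w where w: "w \<in> carrier_vec n" "w \<noteq> 0\<^sub>v n" "A *\<^sub>v w = \<mu> \<cdot>\<^sub>v w"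
      using ev' A unfolding eigenvalue_def eigenvector_def by auto
    have "A *\<^sub>v w = \<mu> \<cdot>\<^sub>v w + 0 \<cdot>\<^sub>v h" unfolding w(3) using w(1) hc by auto
    then obtain \<gamma> where \<gamma>: "w = \<gamma> \<cdot>\<^sub>v h" using rigid[OF w(1) _ gt] by blast
    have "\<gamma> \<noteq> 0" using w(2) hc unfolding \<gamma> by auto
    have Aw: "A *\<^sub>v w = (\<gamma> * ev) \<cdot>\<^sub>v h"
      unfolding \<gamma> using mult_mat_vec[OF A hc] h(2) by (simp add: smult_smult_assoc)
    have "\<mu> \<cdot>\<^sub>v w = (\<mu> * \<gamma>) \<cdot>\<^sub>v h" unfolding \<gamma> by (simp add: smult_smult_assoc)
    then have "(\<gamma> * ev) \<cdot>\<^sub>v h = (\<mu> * \<gamma>) \<cdot>\<^sub>v h" using Aw w(3) by simp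
    from arg_cong[OF this, of "\<lambda>v. v $ 0"] have "\<gamma> * ev = \<mu> * \<gamma>"
      using int_cone_plusD(4)[OF h(1) n] hc n by simp
    with \<open>\<gamma> \<noteq> 0\<close> ne show False by simp
  qed
  have "Polynomial.order ev (char_poly A) = 1"
  proof (rule ccontr)
    assume ne: "Polynomial.order ev (char_poly A) \<noteq> 1"
    have "char_poly A \<noteq> 0" using degree_monic_char_poly[OF A] by auto
    then have "Polynomial.order ev (char_poly A) \<noteq> 0"
      using eig unfolding eigenvalue_root_char_poly[OF A] by (simp add: order_root)
    with ne have "Polynomial.order ev (char_poly A) \<ge> 2" by linarith
    from multiple_eigenvalue_chain[OF A this]
    obtain v w b where vw: "v \<in> carrier_vec n" "w \<in> carrier_vec n" "A *\<^sub>v v = ev \<cdot>\<^sub>v v"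
      "A *\<^sub>v w = ev \<cdot>\<^sub>v w + b \<cdot>\<^sub>v v"
      and indep: "\<And>\<alpha> \<beta> h. h \<in> carrier_vec n \<Longrightarrow> v = \<alpha> \<cdot>\<^sub>v h \<Longrightarrow> w = \<beta> \<cdot>\<^sub>v h \<Longrightarrow> False" by blast
    have "A *\<^sub>v v = ev \<cdot>\<^sub>v v + 0 \<cdot>\<^sub>v h" unfolding vw(3) using vw(1) hc by auto
    then obtain \<alpha> where \<alpha>: "v = \<alpha> \<cdot>\<^sub>v h" using rigid[OF vw(1) _ cev] by blast
    have "A *\<^sub>v w = ev \<cdot>\<^sub>v w + (b * \<alpha>) \<cdot>\<^sub>v h" unfolding vw(4) \<alpha> by (simp add: smult_smult_assoc)
    then obtain \<beta> where "w = \<beta> \<cdot>\<^sub>v h" using rigid[OF vw(2) _ cev] by blast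
    with indep[OF hc \<alpha>] show False by blast
  qed
  moreover have "max_modulus_eigenvalue A ev"
    unfolding max_modulus_eigenvalue_def using eig others cev by (metis less_imp_le order_refl order_trans)
  moreover have "\<mu> = ev" if "max_modulus_eigenvalue A \<mu>" for \<mu>
    using that others eig cev unfolding max_modulus_eigenvalue_def by (meson le_less_trans not_le)
  ultimately show ?thesis
    unfolding spectral_gap_def c_def[symmetric] using others by blast
qed

lemma uniform_strictness:
  fixes f g :: "'a \<Rightarrow> real"
  assumes fin: "finite S" and lt: "\<And>s. s \<in> S \<Longrightarrow> 0 \<le> f s \<and> f s < g s"
  obtains \<theta> where "0 < \<theta>" "\<theta> < 1" "\<And>s. s \<in> S \<Longrightarrow> 1 / \<theta> * f s < g s"
proof -
  define m where "m = Max (insert 0 ((\<lambda>s. f s / g s) ` S))"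
  have m: "m \<in> insert 0 ((\<lambda>s. f s / g s) ` S)" unfolding m_def using fin by (intro Max_in) auto
  have m1: "0 \<le> m" "m < 1"
    using m lt by (auto simp: divide_less_eq_1 intro!: divide_nonneg_nonneg; force)+
  have mle: "f s / g s \<le> m" if "s \<in> S" for s unfolding m_def using fin that by (intro Max_ge) auto
  show thesis
  proof (rule that[of "(1 + m) / 2"])
    fix s assume s: "s \<in> S"
    have g: "g s > 0" using lt[OF s] by linarith
    have "f s \<le> m * g s" using mle[OF s] g by (simp add: field_simps)
    also have "\<dots> < (1 + m) / 2 * g s" using m1 g by (intro mult_strict_right_mono) auto
    finally show "1 / ((1 + m) / 2) * f s < g s" using m1 by (simp add: field_simps)
  qed (use m1 in auto)
qed

text \<open>There are finitely many strict inequalities between the entries, so they hold with a common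
  \<open>\<theta> < 1\<close>, and since no entry vanishes a common \<open>\<sigma>\<close> exists as well. Hence the explicit diameter bound
  applies.\<close>

lemma image_diameter_finite:
  assumes n: "0 < n" and A: "A \<in> carrier_mat n n"
    and M: "(\<lambda>x. A *\<^sub>v x) ` (cone_plus n - {0\<^sub>v n}) \<subseteq> int_cone_plus n"
  shows "image_diameter n A < \<infinity>" and "0 \<le> image_diameter n A"
proof -
  have E: "cmod (A $$ (k,p) * A $$ (l,q) - A $$ (k,q) * A $$ (l,p))
      < Re (cnj (A $$ (k,p)) * A $$ (l,q) + cnj (A $$ (k,q)) * A $$ (l,p))"
    if "k < n" "l < n" "p < n" "q < n" for k l p q
    using maps_cone_iff_entries[OF A] M that by blast
  define S where "S = {..<n} \<times> {..<n} \<times> {..<n} \<times> {..<n}"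
  have fin: "finite S" by (simp add: S_def)
  define F where "F = (\<lambda>(k,l,p,q). cmod (A $$ (k,p) * A $$ (l,q) - A $$ (k,q) * A $$ (l,p)))"
  define G where "G = (\<lambda>(k,l,p,q). Re (cnj (A $$ (k,p)) * A $$ (l,q) + cnj (A $$ (k,q)) * A $$ (l,p)))"
  have "0 \<le> F s \<and> F s < G s" if "s \<in> S" for s
    using that E by (auto simp: S_def F_def G_def simp del: plus_complex.sel times_complex.sel)
  then obtain \<theta> where \<theta>: "0 < \<theta>" "\<theta> < 1" and \<theta>S: "\<And>s. s \<in> S \<Longrightarrow> 1 / \<theta> * F s < G s"
    using uniform_strictness[OF fin, of F G] by blast
  \<comment> \<open>The offset \<open>2\<close> ensures \<open>\<sigma> > 1\<close> and lets \<open>\<sigma>\<^sup>2\<close> dominate \<open>\<sigma>\<close>.\<close>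
  define \<sigma> where "\<sigma> = 2 + (\<Sum>(k,l,p,q)\<in>S. cmod (A $$ (k,p) * A $$ (l,q)) / cmod (A $$ (k,q) * A $$ (l,p)))"
  have nz: "A $$ (k,p) \<noteq> 0" if "k < n" "p < n" for k p using E[OF that(1) that(1) that(2) that(2)] by auto
  have \<sigma>_ge: "\<sigma> \<ge> 2" unfolding \<sigma>_def by (auto intro!: sum_nonneg)
  have ratio: "cmod (A $$ (k,p) * A $$ (l,q)) \<le> \<sigma>\<^sup>2 * cmod (A $$ (k,q) * A $$ (l,p))"
    if "k < n" "l < n" "p < n" "q < n" for k l p q
  proof -
    have "cmod (A $$ (k,p) * A $$ (l,q)) / cmod (A $$ (k,q) * A $$ (l,p)) \<le> \<sigma> - 2"
      unfolding \<sigma>_def using member_le_sum[of "(k,l,p,q)" S "\<lambda>(k,l,p,q). cmod (A $$ (k,p) * A $$ (l,q)) / cmod (A $$ (k,q) * A $$ (l,p))"]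
        that fin by (auto simp: S_def)
    also have "\<dots> \<le> \<sigma> * 1" by simp
    also have "\<dots> \<le> \<sigma>\<^sup>2"
      unfolding power2_eq_square using \<sigma>_ge by (intro mult_left_mono) auto
    finally show ?thesis using nz[OF that(1,4)] nz[OF that(2,3)] by (simp add: field_simps)
  qed
  have "image_diameter n A \<le> ereal (8 * ln ((1 + \<theta>) / (1 - \<theta>)) + 2 * ln \<sigma>)"
  proof (rule image_diameter_le[OF n A \<theta>])
    show "\<sigma> > 1" using \<sigma>_ge by simp
    show "\<forall>k<n. \<forall>l<n. \<forall>p<n. \<forall>q<n.
              Re (cnj (A $$ (k,p)) * A $$ (l,q) + cnj (A $$ (k,q)) * A $$ (l,p))
                > 1 / \<theta> * cmod (A $$ (k,p) * A $$ (l,q) - A $$ (k,q) * A $$ (l,p))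
            \<and> cmod (A $$ (k,p) * A $$ (l,q)) \<le> \<sigma>\<^sup>2 * cmod (A $$ (k,q) * A $$ (l,p))"
    proof (intro allI impI conjI)
      fix k l p q assume kl: "k < n" "l < n" "p < n" "q < n"
      show "1 / \<theta> * cmod (A $$ (k,p) * A $$ (l,q) - A $$ (k,q) * A $$ (l,p))
        < Re (cnj (A $$ (k,p)) * A $$ (l,q) + cnj (A $$ (k,q)) * A $$ (l,p))"
        using \<theta>S[of "(k,l,p,q)"] kl by (simp add: S_def F_def G_def)
      show "cmod (A $$ (k,p) * A $$ (l,q)) \<le> \<sigma>\<^sup>2 * cmod (A $$ (k,q) * A $$ (l,p))"
        by (rule ratio[OF kl])
    qed
  qed
  then show "image_diameter n A < \<infinity>" by (rule le_less_trans) simp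
  have one: "vec n (\<lambda>_. 1) \<in> cone_plus n - {0\<^sub>v n}"
  proof -
    have "vec n (\<lambda>_. 1) $ 0 \<noteq> (0\<^sub>v n :: complex vec) $ 0" using n by simp
    then have "vec n (\<lambda>_. 1) \<noteq> (0\<^sub>v n :: complex vec)" by metis
    then show ?thesis by (simp add: cone_plus_def)
  qed
  have "colinear v v" for v
    unfolding colinear_def by (intro exI[of _ 1] exI[of _ "-1"]) auto
  then have "0 \<le> proj_metric (cone_plus n) (A *\<^sub>v vec n (\<lambda>_. 1)) (A *\<^sub>v vec n (\<lambda>_. 1))"
    by (simp add: proj_metric_def)
  also have "\<dots> \<le> image_diameter n A"
    unfolding image_diameter_def by (rule SUP_upper2[OF one SUP_upper[OF one]])
  finally show "0 \<le> image_diameter n A" .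
qed

theorem theorem1p1:
  fixes n :: nat and A :: "complex mat"
  assumes "n \<ge> 1" and "A \<in> carrier_mat n n"
  shows
    "((\<lambda>x. A *\<^sub>v x) ` (cone_plus n - {0\<^sub>v n}) \<subseteq> int_cone_plus n
        \<longleftrightarrow> (\<forall>k<n. \<forall>l<n. \<forall>p<n. \<forall>q<n.
              Re (cnj (A $$ (k,p)) * A $$ (l,q) + cnj (A $$ (k,q)) * A $$ (l,p))
                > cmod (A $$ (k,p) * A $$ (l,q) - A $$ (k,q) * A $$ (l,p))))
   \<and> ((\<lambda>x. A *\<^sub>v x) ` (cone_plus n - {0\<^sub>v n}) \<subseteq> int_cone_plus n
        \<longrightarrow> image_diameter n A < \<infinity>
          \<and> tanh (real_of_ereal (image_diameter n A) / 4) < 1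
          \<and> spectral_gap A (tanh (real_of_ereal (image_diameter n A) / 4)))
   \<and> (\<forall>\<theta> \<sigma> :: real. 0 < \<theta> \<and> \<theta> < 1 \<and> \<sigma> > 1
        \<and> (\<forall>k<n. \<forall>l<n. \<forall>p<n. \<forall>q<n.
              Re (cnj (A $$ (k,p)) * A $$ (l,q) + cnj (A $$ (k,q)) * A $$ (l,p))
                > 1 / \<theta> * cmod (A $$ (k,p) * A $$ (l,q) - A $$ (k,q) * A $$ (l,p))
            \<and> cmod (A $$ (k,p) * A $$ (l,q)) \<le> \<sigma>\<^sup>2 * cmod (A $$ (k,q) * A $$ (l,p)))
        \<longrightarrow> image_diameter n A \<le> ereal (8 * ln ((1 + \<theta>) / (1 - \<theta>)) + 2 * ln \<sigma>))"
proof (intro conjI impI allI)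
  have n: "0 < n" using assms(1) by simp
  show "(\<lambda>x. A *\<^sub>v x) ` (cone_plus n - {0\<^sub>v n}) \<subseteq> int_cone_plus n
        \<longleftrightarrow> (\<forall>k<n. \<forall>l<n. \<forall>p<n. \<forall>q<n.
              Re (cnj (A $$ (k,p)) * A $$ (l,q) + cnj (A $$ (k,q)) * A $$ (l,p))
                > cmod (A $$ (k,p) * A $$ (l,q) - A $$ (k,q) * A $$ (l,p)))"
    by (rule maps_cone_iff_entries[OF assms(2)])
  show "tanh (real_of_ereal (image_diameter n A) / 4) < 1" by (rule tanh_real_lt_1)
  {
    assume M: "(\<lambda>x. A *\<^sub>v x) ` (cone_plus n - {0\<^sub>v n}) \<subseteq> int_cone_plus n"
    note fin = image_diameter_finite[OF n assms(2) M]
    show "image_diameter n A < \<infinity>" by (rule fin(1))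
    have "image_diameter n A \<le> ereal (real_of_ereal (image_diameter n A))"
      and "0 \<le> real_of_ereal (image_diameter n A)"
      using fin by (cases "image_diameter n A"; simp)+
    then show "spectral_gap A (tanh (real_of_ereal (image_diameter n A) / 4))"
      by (rule spectral_gap_of_cone_map[OF n assms(2) M])
  }
  show "image_diameter n A \<le> ereal (8 * ln ((1 + \<theta>) / (1 - \<theta>)) + 2 * ln \<sigma>)"
    if "0 < \<theta> \<and> \<theta> < 1 \<and> \<sigma> > 1
        \<and> (\<forall>k<n. \<forall>l<n. \<forall>p<n. \<forall>q<n.
              Re (cnj (A $$ (k,p)) * A $$ (l,q) + cnj (A $$ (k,q)) * A $$ (l,p))
                > 1 / \<theta> * cmod (A $$ (k,p) * A $$ (l,q) - A $$ (k,q) * A $$ (l,p))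
            \<and> cmod (A $$ (k,p) * A $$ (l,q)) \<le> \<sigma>\<^sup>2 * cmod (A $$ (k,q) * A $$ (l,p)))" for \<theta> \<sigma>
    using that by (intro image_diameter_le[OF n assms(2)]) blast+
qed

end
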